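(* Let $f(\alpha)=2\cdot 5^{\alpha}-6^{\alpha+1}+4\cdot 7^{\alpha}$ for real $\alpha$, and let $x_0\approx -3.09997$ be a root of the equation $f(\alpha)=0$. Let $n\ge 3$ and let $B_n\in\Omega_n$ be a polyomino chain having $n$ squares. Then, for every real $\alpha\le x_0$, $$\chi_\alpha(B_n)\ge \chi_\alpha(Z_n),$$ where $Z_n$ is the zigzag chain with $n$ squares, with equality if and only if $B_n\cong Z_n$.
   Context: For a graph $G$ and a nonzero real number $\alpha$, the general sum-connectivity index is $\chi_\alpha(G)=\sum_{uv\in E(G)}(d_u+d_v)^\alpha$, where $d_u$ is the degree of the vertex $u$. A polyomino system is a connected geometric figure obtained by concatenating congruent squares side to side in the plane so that the figure divides the plane into one infinite (external) region and a number of finite (internal) regions, all internal regions being congruent squares. Two squares are adjacent if they share a side. A polyomino chain is a polyomino system in which every square is adjacent to at most two other squares; the squares are arranged in a linear order in which exactly the consecutive squares are adjacent (so for $n\ge 2$ there are two terminal squares; the cyclic $2\times 2$ block of four squares is not considered a chain). A polyomino chain is identified with its graph: vertices are the corners of the squares, edges are the sides of the squares. Degrees are taken in this graph, and $\cong$ denotes graph isomorphism. A square adjacent to exactly one (respectively two) other square(s) is called terminal (respectively non-terminal). A kink is a non-terminal square having a vertex of degree 2. A linear chain is a polyomino chain without kinks. The zigzag chain $Z_n$ is the polyomino chain with $n$ squares consisting of only kinks and terminal squares. A segment is a maximal linear chain in a polyomino chain, including the kinks and/or terminal squares at its ends; its length is its number of squares. A segment is external if it contains a terminal square, and internal otherwise.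 $\Omega_n$ is the collection of all polyomino chains with $n$ squares in which no internal segment of length 3 has an edge connecting two vertices of degree 3. *)

theory Defs
  imports "HOL-Analysis.Analysis"
begin

section \<open>Finite simple graphs and the general sum-connectivity index\<close>

text \<open>A simple graph is a pair of a vertex set and a set of edges, every edge being the
  two-element set of its end vertices.\<close>

type_synonym 'a graph = "'a set \<times> 'a set set"

definition verts :: "'a graph \<Rightarrow> 'a set" where
  "verts G = fst G"

definition edges :: "'a graph \<Rightarrow> 'a set set" where
  "edges G = snd G"

definition degree :: "'a graph \<Rightarrow> 'a \<Rightarrow> nat" where
  "degree G v = card {e \<in> edges G. v \<in> e}"

definition graph_iso :: "'a graph \<Rightarrow> 'b graph \<Rightarrow> bool" where
  "graph_iso G H \<longleftrightarrow>
     (\<exists>\<phi>. bij_betw \<phi> (verts G) (verts H) \<and>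
          (\<forall>u\<in>verts G. \<forall>v\<in>verts G. {u, v} \<in> edges G \<longleftrightarrow> {\<phi> u, \<phi> v} \<in> edges H))"

text \<open>For an edge \<open>e = {u, v}\<close> the inner sum is \<open>d\<^sub>u + d\<^sub>v\<close>.\<close>

definition sum_connectivity :: "real \<Rightarrow> 'a graph \<Rightarrow> real" where
  "sum_connectivity \<alpha> G = (\<Sum>e\<in>edges G. real (\<Sum>u\<in>e. degree G u) powr \<alpha>)"


section \<open>Polyomino systems\<close>

text \<open>Congruent squares glued side to side lie, up to a similarity of the plane, on the unit
  lattice. A square is named by its lower left corner.\<close>

type_synonym cell = "int \<times> int"

fun corners :: "cell \<Rightarrow> (int \<times> int) set" where
  "corners (x, y) = {(x, y), (x + 1, y), (x, y + 1), (x + 1, y + 1)}"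

fun sides :: "cell \<Rightarrow> (int \<times> int) set set" where
  "sides (x, y) =
     {{(x, y), (x + 1, y)}, {(x, y + 1), (x + 1, y + 1)},
      {(x, y), (x, y + 1)}, {(x + 1, y), (x + 1, y + 1)}}"

definition adjacent :: "cell \<Rightarrow> cell \<Rightarrow> bool" where
  "adjacent c d \<longleftrightarrow> c \<noteq> d \<and> sides c \<inter> sides d \<noteq> {}"

definition neighbours :: "cell set \<Rightarrow> cell \<Rightarrow> cell set" where
  "neighbours S c = {d \<in> S. adjacent c d}"

definition cell_graph :: "cell set \<Rightarrow> (int \<times> int) graph" where
  "cell_graph S = (\<Union>c\<in>S. corners c, \<Union>c\<in>S. sides c)"

fun unit_square :: "cell \<Rightarrow> complex set" where
  "unit_square (x, y) =
     cbox (Complex (of_int x) (of_int y)) (Complex (of_int (x + 1)) (of_int (y + 1)))"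

definition figure :: "cell set \<Rightarrow> complex set" where
  "figure S = (\<Union>c\<in>S. frontier (unit_square c))"

text \<open>The regions are the connected components of the complement of the drawn figure. The last
  condition says that the squares of the system are exactly its internal regions. In particular
  there are no holes: a hole of unit size is an internal region that is a square, hence
  belongs to \<open>S\<close>, and any other hole is an internal region that is not a square.\<close>

definition polyomino_system :: "cell set \<Rightarrow> bool" where
  "polyomino_system S \<longleftrightarrow>
     finite S \<and> S \<noteq> {} \<and>
     (\<forall>c\<in>S. \<forall>d\<in>S. (c, d) \<in> {(a, b). a \<in> S \<and> b \<in> S \<and> adjacent a b}\<^sup>*) \<and>
     (\<exists>!R. R \<in> components (- figure S) \<and> \<not> bounded R) \<and>
     {R \<in> components (- figure S). bounded R} = (\<lambda>c. interior (unit_square c)) ` S"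


section \<open>Polyomino chains\<close>

text \<open>The linear order excludes the cyclic block of four squares.\<close>

definition polyomino_chain :: "cell set \<Rightarrow> bool" where
  "polyomino_chain S \<longleftrightarrow>
     polyomino_system S \<and>
     (\<forall>c\<in>S. card (neighbours S c) \<le> 2) \<and>
     (\<exists>cs. distinct cs \<and> set cs = S \<and>
        (\<forall>i<length cs. \<forall>j<length cs.
           adjacent (cs ! i) (cs ! j) \<longleftrightarrow> i = Suc j \<or> j = Suc i))"

definition terminal :: "cell set \<Rightarrow> cell \<Rightarrow> bool" where
  "terminal S c \<longleftrightarrow> c \<in> S \<and> card (neighbours S c) = 1"

definition non_terminal :: "cell set \<Rightarrow> cell \<Rightarrow> bool" where
  "non_terminal S c \<longleftrightarrow> c \<in> S \<and> card (neighbours S c) = 2"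

definition kink :: "cell set \<Rightarrow> cell \<Rightarrow> bool" where
  "kink S c \<longleftrightarrow> non_terminal S c \<and> (\<exists>v\<in>corners c. degree (cell_graph S) v = 2)"

definition linear_chain :: "cell set \<Rightarrow> bool" where
  "linear_chain S \<longleftrightarrow> polyomino_chain S \<and> (\<forall>c\<in>S. \<not> kink S c)"

definition zigzag_chain :: "nat \<Rightarrow> cell set \<Rightarrow> bool" where
  "zigzag_chain n S \<longleftrightarrow>
     polyomino_chain S \<and> card S = n \<and> (\<forall>c\<in>S. kink S c \<or> terminal S c)"

text \<open>Linearity of a segment \<open>T\<close> refers to \<open>T\<close> as a chain of its own: its end squares are
  terminal in \<open>T\<close> even if they are kinks of \<open>S\<close>.\<close>

definition segment :: "cell set \<Rightarrow> cell set \<Rightarrow> bool" where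
  "segment S T \<longleftrightarrow>
     T \<subseteq> S \<and> linear_chain T \<and>
     (\<forall>T'. T \<subseteq> T' \<and> T' \<subseteq> S \<and> linear_chain T' \<longrightarrow> T' = T)"

definition external_segment :: "cell set \<Rightarrow> cell set \<Rightarrow> bool" where
  "external_segment S T \<longleftrightarrow> segment S T \<and> (\<exists>c\<in>T. terminal S c)"

definition internal_segment :: "cell set \<Rightarrow> cell set \<Rightarrow> bool" where
  "internal_segment S T \<longleftrightarrow> segment S T \<and> \<not> external_segment S T"

text \<open>The edges are those of the segment; the degrees are taken in the graph of the whole
  chain.\<close>

definition Omega :: "nat \<Rightarrow> cell set set" where
  "Omega n =
     {S. polyomino_chain S \<and> card S = n \<and>
         \<not> (\<exists>T. internal_segment S T \<and> card T = 3 \<and>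
               (\<exists>e\<in>edges (cell_graph T). \<forall>v\<in>e. degree (cell_graph S) v = 3))}"

end

theory Submission
  imports Defs
begin

text \<open>Number the squares of a chain along its order and let \<open>t\<^sub>i\<close> be 1 if square \<open>i\<close> is a kink
  and 0 otherwise. As the system has no holes, squares of a chain meet only if they are at most two
  places apart, so a vertex in \<open>k\<close> squares has degree \<open>k + 1\<close>, and two consecutive squares share a
  side of degree sum \<open>6 + t\<^sub>i + t\<^sub>i\<^sub>+\<^sub>1\<close>. In \<open>\<Omega>\<^sub>n\<close> the outer edges of a square also depend only on
  the numbers \<open>t\<close>, because a straight square between two kinks is excluded unless the chain
  leaves it on opposite sides. The index thus becomes a sum over pairs of consecutive squares: a pair
  with \<open>(t\<^sub>i, t\<^sub>i\<^sub>+\<^sub>1) = (1, 1)\<close>, \<open>(0, 1)\<close>, \<open>(0, 0)\<close> contributes \<open>2 \<cdot> 6\<^sup>\<alpha> + 8\<^sup>\<alpha>\<close>, \<open>5\<^sup>\<alpha> + 2 \<cdot> 7\<^sup>\<alpha>\<close>,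
  \<open>3 \<cdot> 6\<^sup>\<alpha>\<close>, and for \<open>\<alpha> < 0\<close> the first is the smallest. In a minimal chain all inner
  squares are kinks; then the turns alternate and the chain is a staircase, unique up to symmetry.\<close>

section \<open>Lattice cells and vertex degrees\<close>

lemma adjacent_iff:
  "adjacent (a, b) (c, d) \<longleftrightarrow>
     a = c \<and> (d = b + 1 \<or> b = d + 1) \<or> b = d \<and> (c = a + 1 \<or> a = c + 1)"
  by (auto simp: adjacent_def doubleton_eq_iff)

lemma adjacent_sym: "adjacent c d \<longleftrightarrow> adjacent d c"
  by (auto simp: adjacent_def)

lemma horizontal_edge_iff:
  "{(x, y), (x + 1, y)} \<in> edges (cell_graph S) \<longleftrightarrow> (x, y) \<in> S \<or> (x, y - 1) \<in> S"
proof -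
  have "{(x, y), (x + 1, y)} \<in> sides (a, b) \<longleftrightarrow> a = x \<and> (b = y \<or> b = y - 1)" for a b
    by (simp add: doubleton_eq_iff) presburger
  then show ?thesis
    by (auto simp: edges_def cell_graph_def simp del: sides.simps)
qed

lemma vertical_edge_iff:
  "{(x, y), (x, y + 1)} \<in> edges (cell_graph S) \<longleftrightarrow> (x, y) \<in> S \<or> (x - 1, y) \<in> S"
proof -
  have "{(x, y), (x, y + 1)} \<in> sides (a, b) \<longleftrightarrow> b = y \<and> (a = x \<or> a = x - 1)" for a b
    by (simp add: doubleton_eq_iff) presburger
  then show ?thesis
    by (auto simp: edges_def cell_graph_def simp del: sides.simps)
qed

lemma incident_edge:
  assumes "e \<in> sides c" "(x, y) \<in> e"
  shows "e \<in> {{(x, y), (x + 1, y)}, {(x, y), (x, y + 1)}, {(x - 1, y), (x, y)}, {(x, y - 1), (x, y)}}"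
proof -
  obtain a b where c: "c = (a, b)" by force
  have "e = {(a, b), (a + 1, b)} \<or> e = {(a, b + 1), (a + 1, b + 1)} \<or>
      e = {(a, b), (a, b + 1)} \<or> e = {(a + 1, b), (a + 1, b + 1)}"
    using assms(1) by (simp add: c)
  then show ?thesis
    using assms(2) by (elim disjE; simp; elim disjE; simp add: insert_commute)
qed

text \<open>Four lattice edges meet at a vertex, and each is drawn exactly when one of the two cells
  flanking it is in \<open>S\<close>. The summands belong to the edges going right, up, left and
  down.\<close>

lemma degree_quadrants:
  "degree (cell_graph S) (x, y) =
    of_bool ((x, y) \<in> S \<or> (x, y - 1) \<in> S) + of_bool ((x, y) \<in> S \<or> (x - 1, y) \<in> S) +
    of_bool ((x - 1, y) \<in> S \<or> (x - 1, y - 1) \<in> S) +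
    of_bool ((x, y - 1) \<in> S \<or> (x - 1, y - 1) \<in> S)"
proof -
  define E N W T where "E = {(x, y), (x + 1, y)}" and "N = {(x, y), (x, y + 1)}"
    and "W = {(x - 1, y), (x, y)}" and "T = {(x, y - 1), (x, y)}"
  have ne: "E \<noteq> N" "E \<noteq> W" "E \<noteq> T" "N \<noteq> W" "N \<noteq> T" "W \<noteq> T"
    by (auto simp: E_def N_def W_def T_def doubleton_eq_iff)
  have "{e \<in> edges (cell_graph S). (x, y) \<in> e} = {E, N, W, T} \<inter> edges (cell_graph S)"
  proof (intro equalityI subsetI)
    fix e assume e: "e \<in> {e \<in> edges (cell_graph S). (x, y) \<in> e}"
    then obtain c where "e \<in> sides c"
      by (auto simp: edges_def cell_graph_def)
    from incident_edge[OF this, of x y] e show "e \<in> {E, N, W, T} \<inter> edges (cell_graph S)"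
      by (simp add: E_def N_def W_def T_def)
  qed (auto simp: E_def N_def W_def T_def)
  moreover have "E \<in> edges (cell_graph S) \<longleftrightarrow> (x, y) \<in> S \<or> (x, y - 1) \<in> S"
    unfolding E_def by (rule horizontal_edge_iff)
  moreover have "N \<in> edges (cell_graph S) \<longleftrightarrow> (x, y) \<in> S \<or> (x - 1, y) \<in> S"
    unfolding N_def by (rule vertical_edge_iff)
  moreover have "W \<in> edges (cell_graph S) \<longleftrightarrow> (x - 1, y) \<in> S \<or> (x - 1, y - 1) \<in> S"
    using horizontal_edge_iff[of "x - 1" y S] by (simp add: W_def)
  moreover have "T \<in> edges (cell_graph S) \<longleftrightarrow> (x, y - 1) \<in> S \<or> (x - 1, y - 1) \<in> S"
    using vertical_edge_iff[of x "y - 1" S] by (simp add: T_def)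
  ultimately show ?thesis
    using ne by (simp add: degree_def Int_insert_left)
qed

lemma mem_corners_iff:
  "(x, y) \<in> corners c \<longleftrightarrow> c \<in> {(x, y), (x - 1, y), (x - 1, y - 1), (x, y - 1)}"
  by (cases c) auto

text \<open>A vertex surrounded by four squares, or by two squares touching only diagonally, has
  degree 4 without lying in three squares.\<close>

lemma degree_eq_Suc_card:
  assumes ne: "{c \<in> S. v \<in> corners c} \<noteq> {}"
    and le3: "card {c \<in> S. v \<in> corners c} \<le> 3"
    and diag: "\<And>x y. (x, y) \<in> S \<Longrightarrow> (x + 1, y + 1) \<in> S \<Longrightarrow> (x + 1, y) \<in> S \<or> (x, y + 1) \<in> S"
    and diag': "\<And>x y. (x + 1, y) \<in> S \<Longrightarrow> (x, y + 1) \<in> S \<Longrightarrow> (x, y) \<in> S \<or> (x + 1, y + 1) \<in> S"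
  shows "degree (cell_graph S) v = Suc (card {c \<in> S. v \<in> corners c})"
proof -
  obtain x y where v: "v = (x, y)" by force
  let ?Q = "{(x, y), (x - 1, y), (x - 1, y - 1), (x, y - 1)}"
  have "{c \<in> S. v \<in> corners c} = S \<inter> ?Q"
    by (auto simp: v mem_corners_iff)
  moreover have "card (S \<inter> ?Q) = of_bool ((x, y) \<in> S) + of_bool ((x - 1, y) \<in> S)
      + of_bool ((x - 1, y - 1) \<in> S) + of_bool ((x, y - 1) \<in> S)"
    by simp
  ultimately show ?thesis
    using ne le3 diag[of "x - 1" "y - 1"] diag'[of "x - 1" "y - 1"]
    by (auto simp: v degree_quadrants)
qed

section \<open>Relative position of two and three consecutive squares\<close>

lemma sides_Int_adjacent:
  assumes "adjacent c d"
  shows "sides c \<inter> sides d = {corners c \<inter> corners d}"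
proof -
  obtain a b where c: "c = (a, b)" by force
  obtain a' b' where d: "d = (a', b')" by force
  have "d \<in> {(a - 1, b), (a + 1, b), (a, b - 1), (a, b + 1)}"
    using assms by (auto simp: c d adjacent_iff)
  then show ?thesis
    unfolding c by (elim insertE emptyE) (simp_all add: doubleton_eq_iff)
qed

text \<open>Frees the degree computations from coordinates. In a turn, \<open>v\<close> is the
  corner common to all three squares and \<open>r\<close> the corner of \<open>d\<close> opposite to
  it; in a straight passage, \<open>{a, a'}\<close> and \<open>{b, b'}\<close> are the outer edges.
  The twelve cases are the ordered pairs of distinct neighbours of \<open>d\<close>.\<close>

lemma three_cells:
  assumes "adjacent c d" "adjacent d e" "c \<noteq> e"
  obtains (turn) v p q r where "distinct [v, p, q, r]" "corners d = {v, p, q, r}"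
      "corners c \<inter> corners d = {v, p}" "corners d \<inter> corners e = {v, q}"
      "corners c \<inter> corners e = {v}" "sides d = {{v, p}, {v, q}, {p, r}, {q, r}}"
  | (straight) a b a' b' where "distinct [a, b, a', b']" "corners d = {a, b, a', b'}"
      "corners c \<inter> corners d = {a, b}" "corners d \<inter> corners e = {a', b'}"
      "corners c \<inter> corners e = {}" "sides d = {{a, b}, {a', b'}, {a, a'}, {b, b'}}"
proof -
  obtain x y where d: "d = (x, y)" by force
  have c: "c \<in> {(x - 1, y), (x + 1, y), (x, y - 1), (x, y + 1)}"
    using assms(1) by (cases c) (auto simp: d adjacent_iff)
  have e: "e \<in> {(x - 1, y), (x + 1, y), (x, y - 1), (x, y + 1)}"
    using assms(2) by (cases e) (auto simp: d adjacent_iff)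
  let ?A = "(x, y)" and ?B = "(x + 1, y)" and ?C = "(x, y + 1)" and ?D = "(x + 1, y + 1)"
  consider "c = (x - 1, y)" "e = (x + 1, y)" | "c = (x + 1, y)" "e = (x - 1, y)"
    | "c = (x, y - 1)" "e = (x, y + 1)" | "c = (x, y + 1)" "e = (x, y - 1)"
    | "c = (x - 1, y)" "e = (x, y - 1)" | "c = (x - 1, y)" "e = (x, y + 1)"
    | "c = (x + 1, y)" "e = (x, y - 1)" | "c = (x + 1, y)" "e = (x, y + 1)"
    | "c = (x, y - 1)" "e = (x - 1, y)" | "c = (x, y - 1)" "e = (x + 1, y)"
    | "c = (x, y + 1)" "e = (x - 1, y)" | "c = (x, y + 1)" "e = (x + 1, y)"
    using c e assms(3) by (elim insertE emptyE; simp)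
  then show ?thesis
  proof cases
    case 1 show ?thesis by (rule straight[of ?A ?C ?B ?D]) (simp_all add: d 1 insert_commute)
  next case 2 show ?thesis by (rule straight[of ?B ?D ?A ?C]) (simp_all add: d 2 insert_commute)
  next case 3 show ?thesis by (rule straight[of ?A ?B ?C ?D]) (simp_all add: d 3 insert_commute)
  next case 4 show ?thesis by (rule straight[of ?C ?D ?A ?B]) (simp_all add: d 4 insert_commute)
  next case 5 show ?thesis by (rule turn[of ?A ?C ?B ?D]) (simp_all add: d 5 insert_commute)
  next case 6 show ?thesis by (rule turn[of ?C ?A ?D ?B]) (simp_all add: d 6 insert_commute)
  next case 7 show ?thesis by (rule turn[of ?B ?D ?A ?C]) (simp_all add: d 7 insert_commute)
  next case 8 show ?thesis by (rule turn[of ?D ?B ?C ?A]) (simp_all add: d 8 insert_commute)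
  next case 9 show ?thesis by (rule turn[of ?A ?B ?C ?D]) (simp_all add: d 9 insert_commute)
  next case 10 show ?thesis by (rule turn[of ?B ?A ?D ?C]) (simp_all add: d 10 insert_commute)
  next case 11 show ?thesis by (rule turn[of ?C ?D ?A ?B]) (simp_all add: d 11 insert_commute)
  next case 12 show ?thesis by (rule turn[of ?D ?C ?B ?A]) (simp_all add: d 12 insert_commute)
  qed
qed

lemma two_cells:
  assumes "adjacent c d"
  obtains a b a' b' where "distinct [a, b, a', b']" "corners c = {a, b, a', b'}"
    "corners c \<inter> corners d = {a, b}" "sides c = {{a, b}, {a', b'}, {a, a'}, {b, b'}}"
proof -
  obtain x y where c: "c = (x, y)" by force
  obtain x' y' where d: "d = (x', y')" by force
  \<comment> \<open>The reflection of \<open>d\<close> in \<open>c\<close>, so that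
    \<open>d\<close>, \<open>c\<close>, \<open>e\<close> form the straight case of
    \<open>three_cells\<close>.\<close>
  define e where "e = (2 * x - x', 2 * y - y')"
  have "adjacent e c" "e \<noteq> d" "corners e \<inter> corners d = {}"
    using assms by (auto simp: e_def c d adjacent_iff)
  then have "adjacent d c" "adjacent c e" "d \<noteq> e" and disj: "corners d \<inter> corners e = {}"
    using assms adjacent_sym by auto
  from this(1-3) show thesis
  proof (cases rule: three_cells[of d c e])
    case (turn v p q r)
    then show ?thesis using disj by simp
  next
    case (straight a b a' b')
    then show ?thesis using that[of a b a' b'] by (simp add: Int_commute)
  qed
qed

section \<open>Absence of diagonal contacts\<close>

text \<open>Adjacency-connectedness of the cells outside \<open>S\<close>, phrased by invariants.\<close>

definition connected_outside :: "cell set \<Rightarrow> bool" where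
  "connected_outside S \<longleftrightarrow>
     (\<forall>H :: cell \<Rightarrow> int. (\<forall>p q. p \<notin> S \<and> q \<notin> S \<and> adjacent p q \<longrightarrow> H p = H q) \<longrightarrow>
        (\<forall>p q. p \<notin> S \<and> q \<notin> S \<longrightarrow> H p = H q))"

section \<open>From regions of the plane to adjacency of cells\<close>

lemma mem_unit_square:
  "z \<in> unit_square (x, y) \<longleftrightarrow>
     of_int x \<le> Re z \<and> Re z \<le> of_int x + 1 \<and> of_int y \<le> Im z \<and> Im z \<le> of_int y + 1"
  by (auto simp: in_cbox_complex_iff)

lemma mem_interior_unit_square:
  "z \<in> interior (unit_square (x, y)) \<longleftrightarrow>
     of_int x < Re z \<and> Re z < of_int x + 1 \<and> of_int y < Im z \<and> Im z < of_int y + 1"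
  by (auto simp: interior_cbox in_box_complex_iff)

lemma interior_unit_square_disjoint:
  assumes "z \<in> interior (unit_square c)" "z \<in> unit_square d"
  shows "c = d"
proof -
  obtain a b a' b' where cd: "c = (a, b)" "d = (a', b')"
    by (cases c, cases d)
  have "a = a'" "b = b'"
    using assms unfolding cd mem_unit_square mem_interior_unit_square by linarith+
  then show ?thesis by (simp add: cd)
qed

lemma compl_figure:
  "- figure S = (\<Union>c\<in>S. interior (unit_square c)) \<union> - (\<Union>c\<in>S. unit_square c)"
proof -
  have "closed (unit_square c)" for c
    by (cases c) (simp only: unit_square.simps closed_cbox)
  then have fr: "frontier (unit_square c) = unit_square c - interior (unit_square c)" for c
    by (simp add: frontier_def)
  show ?thesis
    using interior_subset interior_unit_square_disjoint
    unfolding figure_def fr by fast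
qed

text \<open>Two closed squares through \<open>z\<close> may touch only diagonally. Then the cell in
  the column of \<open>d\<close> and the row of \<open>c\<close> links them: its square also
  contains \<open>z\<close>, so it is outside \<open>S\<close>.\<close>

lemma unit_squares_common_point:
  assumes z: "z \<in> unit_square c" "z \<in> unit_square d"
    and outside: "\<And>e. e \<in> S \<Longrightarrow> z \<notin> unit_square e"
    and H: "\<And>p q. p \<notin> S \<Longrightarrow> q \<notin> S \<Longrightarrow> adjacent p q \<Longrightarrow> H p = H q"
  shows "H c = H d"
proof -
  obtain a b where c: "c = (a, b)" by (cases c)
  obtain a' b' where d: "d = (a', b')" by (cases d)
  define e where "e = (a', b)"
  have step: "H p = H q" if "p = q \<or> adjacent p q" "z \<in> unit_square p" "z \<in> unit_square q" for p q
    using that H outside by blast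
  have "a' = a \<or> a' = a + 1 \<or> a = a' + 1" "b' = b \<or> b' = b + 1 \<or> b = b' + 1"
    using z unfolding c d mem_unit_square by linarith+
  then have "c = e \<or> adjacent c e" "e = d \<or> adjacent e d"
    by (auto simp: c d e_def adjacent_iff)
  moreover have "z \<in> unit_square e"
    using z unfolding c d e_def mem_unit_square by auto
  ultimately show ?thesis
    using step z by metis
qed

text \<open>The floor may jump at \<open>x\<close>, but only between the lower ends of the unit
  intervals that contain \<open>x\<close>.\<close>

lemma eventually_floor_near:
  fixes x :: real
  shows "eventually (\<lambda>w. of_int \<lfloor>w\<rfloor> \<le> x \<and> x \<le> of_int \<lfloor>w\<rfloor> + 1) (nhds x)"
proof -
  have "x < of_int \<lfloor>x\<rfloor> + 1" "of_int (\<lceil>x\<rceil> - 1) < x"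
    by linarith+
  note order_tendstoD(2)[OF filterlim_ident this(1)] order_tendstoD(1)[OF filterlim_ident this(2)]
  then show ?thesis
  proof eventually_elim
    case (elim w)
    then have "\<lfloor>w\<rfloor> \<le> \<lfloor>x\<rfloor>" "\<lceil>x\<rceil> \<le> \<lfloor>w\<rfloor> + 1" by linarith+
    then show ?case by linarith
  qed
qed

text \<open>The bounded regions are the open squares of \<open>S\<close>, so every cell outside
  \<open>S\<close> has its midpoint in the unbounded region \<open>R\<close>. An invariant
  \<open>H\<close>, read off at the cell containing a point, is locally constant on the connected
  set \<open>R\<close>, hence constant.\<close>

lemma connected_outside_polyomino_system:
  assumes "polyomino_system S"
  shows "connected_outside S"
  unfolding connected_outside_def
proof (intro allI impI, elim conjE)
  fix H :: "cell \<Rightarrow> int" and p q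
  assume H: "\<forall>p q. p \<notin> S \<and> q \<notin> S \<and> adjacent p q \<longrightarrow> H p = H q" and pq: "p \<notin> S" "q \<notin> S"
  obtain R where R: "R \<in> components (- figure S)" "\<not> bounded R"
    and uniq: "\<And>R'. R' \<in> components (- figure S) \<Longrightarrow> \<not> bounded R' \<Longrightarrow> R' = R"
    using assms unfolding polyomino_system_def by (metis (no_types, lifting))
  have bdd: "{R \<in> components (- figure S). bounded R} = (\<lambda>c. interior (unit_square c)) ` S"
    using assms unfolding polyomino_system_def by auto
  \<comment> \<open>A point of \<open>R\<close> in a closed square of \<open>S\<close> would be
    interior to it, because \<open>R\<close> avoids the figure; but that interior is a different
    region.\<close>
  have R_outside: "z \<notin> unit_square c" if "z \<in> R" "c \<in> S" for z c
  proof
    assume "z \<in> unit_square c"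
    then have "z \<in> interior (unit_square c)"
      using that R(1)[THEN in_components_subset] interior_unit_square_disjoint
      unfolding compl_figure by fast
    moreover have "interior (unit_square c) \<in> components (- figure S)" "bounded (interior (unit_square c))"
      using bdd that by auto
    ultimately show False
      using components_nonoverlap[OF R(1)] R(2) \<open>z \<in> R\<close> by blast
  qed
  define mid :: "cell \<Rightarrow> complex" where "mid = (\<lambda>(x, y). Complex (of_int x + 1 / 2) (of_int y + 1 / 2))"
  have mid: "mid c \<in> interior (unit_square c)" for c
    by (cases c) (simp only: mid_def mem_interior_unit_square, simp)
  have mid_R: "mid c \<in> R" if "c \<notin> S" for c
  proof -
    have "mid c \<in> - figure S"
      unfolding compl_figure using mid interior_unit_square_disjoint that by blast
    then obtain R' where R': "R' \<in> components (- figure S)" "mid c \<in> R'"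
      by (metis Union_components UnionE)
    have "\<not> bounded R'"
    proof
      assume "bounded R'"
      then obtain d where "d \<in> S" "R' = interior (unit_square d)"
        using R' bdd by (metis (no_types, lifting) imageE mem_Collect_eq)
      then show False
        using interior_unit_square_disjoint[OF mid] R'(2) interior_subset that by blast
    qed
    then show ?thesis using uniq R' by blast
  qed
  define cell_at :: "complex \<Rightarrow> cell" where "cell_at = (\<lambda>z. (\<lfloor>Re z\<rfloor>, \<lfloor>Im z\<rfloor>))"
  have at: "z \<in> unit_square (cell_at z)" for z
    unfolding cell_at_def mem_unit_square by linarith
  have "(H \<circ> cell_at) constant_on R"
  proof (rule locally_constant_imp_constant)
    show "connected R" using R(1) by (rule in_components_connected)
    fix z assume "z \<in> R"
    \<comment> \<open>If \<open>z\<close> lies on a grid line, \<open>cell_at\<close> may jump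
      there, but the cells of all nearby points still have \<open>z\<close> in their closed
      squares.\<close>
    have "eventually (\<lambda>w. z \<in> unit_square (cell_at w)) (nhds z)"
    proof -
      have "(Re \<longlongrightarrow> Re z) (nhds z)" "(Im \<longlongrightarrow> Im z) (nhds z)"
        by (intro tendsto_intros filterlim_ident)+
      from this[unfolded filterlim_def le_filter_def, rule_format]
      have "eventually (\<lambda>w. P (Re w)) (nhds z)" if "eventually P (nhds (Re z))" for P
        using that by (simp add: eventually_filtermap)
      note re = this[OF eventually_floor_near]
      have "eventually (\<lambda>w. P (Im w)) (nhds z)" if "eventually P (nhds (Im z))" for P
        using that \<open>(Im \<longlongrightarrow> Im z) (nhds z)\<close>
        by (auto simp: filterlim_def le_filter_def eventually_filtermap)
      note im = this[OF eventually_floor_near]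
      from re im show ?thesis
        by eventually_elim (auto simp: cell_at_def mem_unit_square simp del: unit_square.simps)
    qed
    then obtain T where T: "open T" "z \<in> T" "\<And>w. w \<in> T \<Longrightarrow> z \<in> unit_square (cell_at w)"
      unfolding eventually_nhds by blast
    show "\<exists>T. openin (top_of_set R) T \<and> z \<in> T \<and> (\<forall>w\<in>T. (H \<circ> cell_at) w = (H \<circ> cell_at) z)"
    proof (intro exI conjI ballI)
      show "openin (top_of_set R) (R \<inter> T)" using T(1) by auto
      show "z \<in> R \<inter> T" using \<open>z \<in> R\<close> T by auto
      fix w assume "w \<in> R \<inter> T"
      then show "(H \<circ> cell_at) w = (H \<circ> cell_at) z"
        using unit_squares_common_point[OF T(3) at, of w S H] R_outside[OF \<open>z \<in> R\<close>] H by auto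
    qed
  qed
  then have "H (cell_at (mid p)) = H (cell_at (mid q))"
    using mid_R pq unfolding constant_on_def by (metis comp_apply)
  moreover have "cell_at (mid c) = c" for c
    using interior_unit_square_disjoint[OF mid at] by metis
  ultimately show "H p = H q" by simp
qed

section \<open>A crossing number for closed walks\<close>

text \<open>Above row \<open>y\<close>, the net rightward crossings of the left border of column
  \<open>x + 1\<close> minus those of its right border give the change of the indicator of being in
  that column. Vertical steps leave the indicator fixed because the cell \<open>(x + 1, y)\<close>
  is not visited.\<close>

lemma crossing_balance:
  fixes a b a' b' x y :: int
  assumes "a = a' \<and> (b' = b + 1 \<or> b = b' + 1) \<or> b = b' \<and> (a' = a + 1 \<or> a = a' + 1)"
    and "\<not> (a = x + 1 \<and> b = y)" "\<not> (a' = x + 1 \<and> b' = y)"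
  shows "(of_bool (b = b' \<and> y < b \<and> a = x \<and> a' = x + 1) - of_bool (b = b' \<and> y < b \<and> a = x + 1 \<and> a' = x)) -
      (of_bool (b = b' \<and> y < b \<and> a = x + 1 \<and> a' = x + 1 + 1) -
       of_bool (b = b' \<and> y < b \<and> a = x + 1 + 1 \<and> a' = x + 1)) =
    (of_bool (a' = x + 1 \<and> y < b') - of_bool (a = x + 1 \<and> y < b) :: int)"
proof -
  consider "a' = a" "b' = b + 1" | "a' = a" "b = b' + 1" | "b' = b" "a' = a + 1" | "b' = b" "a = a' + 1"
    using assms(1) by blast
  then show ?thesis
  proof cases
    case 1 
    then have "a = x + 1 \<Longrightarrow> y < b' \<longleftrightarrow> y < b" using assms by auto
    with 1 show ?thesis by (cases "a = x + 1") simp_all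
  next
    case 2
    then have "a = x + 1 \<Longrightarrow> y < b' \<longleftrightarrow> y < b" using assms by auto
    with 2 show ?thesis by (cases "a = x + 1") simp_all
  next
    case 3
    show ?thesis unfolding 3 by auto
  next
    case 4
    show ?thesis unfolding 4 by auto
  qed
qed

text \<open>A walk in \<open>S\<close> from \<open>(x\<^sub>0, y\<^sub>0)\<close> to \<open>(x\<^sub>0 + 1, y\<^sub>0 + 1)\<close> is closed by a diagonal step through
  the common corner. \<open>H (x, y)\<close> counts, with sign, how often the closed walk crosses the line
  between the columns \<open>x\<close> and \<open>x + 1\<close> above the row \<open>y\<close>; as a kind of winding number it is
  invariant off \<open>S\<close>, but it differs between the two cells on either side of the diagonal step.\<close>

lemma no_diagonal_contact:
  fixes P :: "nat \<Rightarrow> cell" and x\<^sub>0 y\<^sub>0 :: int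
  assumes S: "connected_outside S"
    and ends: "P 0 = (x\<^sub>0, y\<^sub>0)" "P m = (x\<^sub>0 + 1, y\<^sub>0 + 1)"
    and walk: "\<And>k. k < m \<Longrightarrow> adjacent (P k) (P (Suc k))"
    and in_S: "\<And>k. k \<le> m \<Longrightarrow> P k \<in> S"
  shows "(x\<^sub>0 + 1, y\<^sub>0) \<in> S \<or> (x\<^sub>0, y\<^sub>0 + 1) \<in> S"
proof (rule ccontr)
  assume "\<not> ?thesis"
  then have a: "(x\<^sub>0 + 1, y\<^sub>0) \<notin> S" and b: "(x\<^sub>0, y\<^sub>0 + 1) \<notin> S" by auto
  define X Y where "X = (\<lambda>k. fst (P k))" and "Y = (\<lambda>k. snd (P k))"
  have P: "P k = (X k, Y k)" for k by (simp add: X_def Y_def)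
  have step: "X k = X (Suc k) \<and> (Y (Suc k) = Y k + 1 \<or> Y k = Y (Suc k) + 1) \<or>
      Y k = Y (Suc k) \<and> (X (Suc k) = X k + 1 \<or> X k = X (Suc k) + 1)" if "k < m" for k
    using walk[OF that] unfolding P adjacent_iff .
  define cr :: "int \<Rightarrow> int \<Rightarrow> nat \<Rightarrow> int" where
    "cr x y k = of_bool (Y k = Y (Suc k) \<and> Y k > y \<and> X k = x \<and> X (Suc k) = x + 1) -
      of_bool (Y k = Y (Suc k) \<and> Y k > y \<and> X k = x + 1 \<and> X (Suc k) = x)" for x y k
  define C where "C x y = (\<Sum>k<m. cr x y k)" for x y
  \<comment> \<open>The subtracted term is the closing diagonal step: it crosses leftwards between
    the rows \<open>y\<^sub>0\<close> and \<open>y\<^sub>0 + 1\<close>, hence above row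
    \<open>y\<close> exactly when \<open>y \<le> y\<^sub>0\<close>.\<close>
  define H where "H = (\<lambda>(x, y). C x y - of_bool (x = x\<^sub>0 \<and> y \<le> y\<^sub>0))"
  \<comment> \<open>The two counts differ only by crossings in row \<open>y + 1\<close>, and such a
    crossing visits both cells of the premise.\<close>
  have vert: "C x y = C x (y + 1)" if "(x, y + 1) \<notin> S \<or> (x + 1, y + 1) \<notin> S" for x y
    unfolding C_def
  proof (rule sum.cong[OF refl])
    fix k assume "k \<in> {..<m}"
    then have "P k \<in> S" "P (Suc k) \<in> S" using in_S by auto
    then have "Y k = Y (Suc k) \<longrightarrow> Y k = y + 1 \<longrightarrow>
        \<not> (X k = x \<and> X (Suc k) = x + 1) \<and> \<not> (X k = x + 1 \<and> X (Suc k) = x)"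
      using that unfolding P by auto
    then show "cr x y k = cr x (y + 1) k"
      unfolding cr_def by (cases "Y k = y + 1") (auto simp: of_bool_def)
  qed
  have horiz: "C x y - C (x + 1) y = of_bool (x = x\<^sub>0 \<and> y \<le> y\<^sub>0) - of_bool (x + 1 = x\<^sub>0 \<and> y < y\<^sub>0)"
    if "(x + 1, y) \<notin> S" for x y
  proof -
    define r :: "nat \<Rightarrow> int" where "r k = of_bool (X k = x + 1 \<and> y < Y k)" for k
    have "C x y - C (x + 1) y = (\<Sum>k<m. r (Suc k) - r k)"
      unfolding C_def sum_subtractf[symmetric]
    proof (rule sum.cong[OF refl])
      fix k assume "k \<in> {..<m}"
      then have "P k \<in> S" "P (Suc k) \<in> S" "k < m" using in_S by auto
      then have "\<not> (X k = x + 1 \<and> Y k = y)" "\<not> (X (Suc k) = x + 1 \<and> Y (Suc k) = y)"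
        using that unfolding P by auto
      with step[OF \<open>k < m\<close>] show "cr x y k - cr (x + 1) y k = r (Suc k) - r k"
        unfolding cr_def r_def by (rule crossing_balance)
    qed
    also have "\<dots> = r m - r 0" by (rule sum_lessThan_telescope)
    also have "\<dots> = of_bool (x = x\<^sub>0 \<and> y \<le> y\<^sub>0) - of_bool (x + 1 = x\<^sub>0 \<and> y < y\<^sub>0)"
      using ends unfolding r_def P by auto
    finally show ?thesis .
  qed
  \<comment> \<open>The correction terms below can fail to match only at the cell
    \<open>(x\<^sub>0, y\<^sub>0)\<close>, which is excluded because it lies in
    \<open>S\<close>.\<close>
  have 0: "(x\<^sub>0, y\<^sub>0) \<in> S" using in_S[of 0] ends by simp
  have H_vert: "H (x, y) = H (x, y + 1)" if "(x, y) \<notin> S" "(x, y + 1) \<notin> S" for x y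
  proof -
    have "x = x\<^sub>0 \<and> y \<le> y\<^sub>0 \<longleftrightarrow> x = x\<^sub>0 \<and> y + 1 \<le> y\<^sub>0"
      using that 0 by (cases "y = y\<^sub>0") auto
    then show ?thesis using vert[of x y] that by (simp add: H_def)
  qed
  have H_horiz: "H (x, y) = H (x + 1, y)" if "(x, y) \<notin> S" "(x + 1, y) \<notin> S" for x y
  proof -
    have "x + 1 = x\<^sub>0 \<and> y \<le> y\<^sub>0 \<longleftrightarrow> x + 1 = x\<^sub>0 \<and> y < y\<^sub>0"
      using that 0 by (cases "y = y\<^sub>0") auto
    then show ?thesis using horiz[of x y] that by (simp add: H_def)
  qed
  have "H p = H q" if "p \<notin> S" "q \<notin> S" "adjacent p q" for p q
    using that H_vert H_horiz by (cases p; cases q) (auto simp: adjacent_iff)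
  then have "H (x\<^sub>0 + 1, y\<^sub>0) = H (x\<^sub>0, y\<^sub>0 + 1)"
    using S a b unfolding connected_outside_def by blast
  moreover have "C x\<^sub>0 y\<^sub>0 - C (x\<^sub>0 + 1) y\<^sub>0 = 1"
    using horiz[OF a] by simp
  moreover have "C x\<^sub>0 y\<^sub>0 = C x\<^sub>0 (y\<^sub>0 + 1)"
    using vert b by blast
  ultimately show False by (simp add: H_def)
qed

text \<open>Carries \<open>no_diagonal_contact\<close> over to the other diagonal direction.\<close>

lemma connected_outside_mirror:
  assumes "connected_outside S"
  shows "connected_outside {(x, y). (- x, y) \<in> S}"
  unfolding connected_outside_def
proof (intro allI impI, elim conjE)
  let ?S = "{(x, y). (- x, y) \<in> S}"
  fix H :: "cell \<Rightarrow> int" and p q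
  assume H: "\<forall>p q. p \<notin> ?S \<and> q \<notin> ?S \<and> adjacent p q \<longrightarrow> H p = H q" and pq: "p \<notin> ?S" "q \<notin> ?S"
  define G where "G = (\<lambda>(x, y). H (- x, y))"
  have G: "G p = G q" if "p \<notin> S" "q \<notin> S" "adjacent p q" for p q
  proof -
    obtain a b c d where pq: "p = (a, b)" "q = (c, d)" by (cases p, cases q)
    show ?thesis
      using that H[rule_format, of "(- a, b)" "(- c, d)"] by (auto simp: pq G_def adjacent_iff)
  qed
  obtain a b c d where eq: "p = (a, b)" "q = (c, d)" by (cases p, cases q)
  have "G (- a, b) = G (- c, d)"
    using assms G pq unfolding connected_outside_def eq by blast
  then show "H p = H q" by (simp add: G_def eq)
qed

section \<open>Chains as lists of cells\<close>

declare corners.simps [simp del] sides.simps [simp del]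

text \<open>The four cells around \<open>v\<close> form a cycle of adjacencies. Two opposite ones
  are joined through a third cell of \<open>S\<close> by the diagonal hypotheses.\<close>

lemma common_corner:
  assumes "v \<in> corners p" "v \<in> corners q" "p \<noteq> q" "p \<in> S" "q \<in> S"
    and diag: "\<And>x y. (x, y) \<in> S \<Longrightarrow> (x + 1, y + 1) \<in> S \<Longrightarrow> (x + 1, y) \<in> S \<or> (x, y + 1) \<in> S"
    and diag': "\<And>x y. (x + 1, y) \<in> S \<Longrightarrow> (x, y + 1) \<in> S \<Longrightarrow> (x, y) \<in> S \<or> (x + 1, y + 1) \<in> S"
  shows "adjacent p q \<or> (\<exists>r\<in>S. adjacent p r \<and> adjacent r q \<and> v \<in> corners r)"
proof -
  obtain x y where v: "v = (x, y)" by force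
  let ?A = "(x, y)" and ?B = "(x - 1, y)" and ?C = "(x - 1, y - 1)" and ?D = "(x, y - 1)"
  have "p \<in> {?A, ?B, ?C, ?D}" and "q \<in> {?A, ?B, ?C, ?D}"
    using assms(1,2) unfolding v mem_corners_iff by auto
  moreover have "adjacent ?A ?B" "adjacent ?B ?A" "adjacent ?B ?C" "adjacent ?C ?B"
      "adjacent ?C ?D" "adjacent ?D ?C" "adjacent ?D ?A" "adjacent ?A ?D"
    by (simp_all add: adjacent_iff)
  moreover have "v \<in> corners ?A" "v \<in> corners ?B" "v \<in> corners ?C" "v \<in> corners ?D"
    by (simp_all add: v mem_corners_iff)
  moreover have "?C \<in> S \<Longrightarrow> ?A \<in> S \<Longrightarrow> ?D \<in> S \<or> ?B \<in> S" "?D \<in> S \<Longrightarrow> ?B \<in> S \<Longrightarrow> ?C \<in> S \<or> ?A \<in> S"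
    using diag[of "x - 1" "y - 1"] diag'[of "x - 1" "y - 1"] by simp_all
  ultimately show ?thesis
    using assms(3-5) by (elim insertE emptyE) blast+
qed

lemma card_subsingleton:
  assumes "\<And>u v. u \<in> X \<Longrightarrow> v \<in> X \<Longrightarrow> u = v"
  shows "card X = of_bool (X \<noteq> {})"
proof (cases "X = {}")
  case False
  then obtain u where "X = {u}" using assms by blast
  then show ?thesis by simp
qed simp

lemma sum_four_cycle:
  assumes "distinct [a, b, a', b']"
  shows "sum F {{a, b}, {a', b'}, {a, a'}, {b, b'}} = F {a, b} + F {a', b'} + F {a, a'} + F {b, b'}"
proof -
  have "{a, b} \<noteq> {a', b'}" "{a, b} \<noteq> {a, a'}" "{a, b} \<noteq> {b, b'}" "{a', b'} \<noteq> {a, a'}"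
      "{a', b'} \<noteq> {b, b'}" "{a, a'} \<noteq> {b, b'}"
    using assms by (auto simp: doubleton_eq_iff)
  then show ?thesis by (simp add: add.assoc)
qed

text \<open>What the condition on regions contributes to vertex degrees is condensed into
  \<open>diag\<close> and \<open>diag'\<close>; the rest is the linear order.\<close>

locale cell_path =
  fixes cs :: "cell list"
  assumes dist: "distinct cs"
    and adj: "i < length cs \<Longrightarrow> j < length cs \<Longrightarrow>
      adjacent (cs ! i) (cs ! j) \<longleftrightarrow> i = Suc j \<or> j = Suc i"
    and diag: "(x, y) \<in> set cs \<Longrightarrow> (x + 1, y + 1) \<in> set cs \<Longrightarrow>
      (x + 1, y) \<in> set cs \<or> (x, y + 1) \<in> set cs"
    and diag': "(x + 1, y) \<in> set cs \<Longrightarrow> (x, y + 1) \<in> set cs \<Longrightarrow>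
      (x, y) \<in> set cs \<or> (x + 1, y + 1) \<in> set cs"
begin

abbreviation deg :: "int \<times> int \<Rightarrow> nat" where
  "deg \<equiv> degree (cell_graph (set cs))"

text \<open>The squares are numbered from 1, so that no case distinction is needed at the ends.\<close>

definition crn :: "nat \<Rightarrow> (int \<times> int) set" where
  "crn i = (if 1 \<le> i \<and> i \<le> length cs then corners (cs ! (i - 1)) else {})"

text \<open>The number \<open>t\<^sub>i\<close>: the chain turns at a square iff the squares before
  and after it still meet. The empty values of \<open>crn\<close> out of range make it 0 at both
  ends of the chain.\<close>

definition trn :: "nat \<Rightarrow> nat" where
  "trn i = of_bool (crn (i - 1) \<inter> crn (Suc i) \<noteq> {})"

lemma crn_0 [simp]: "crn 0 = {}"
  by (simp add: crn_def)

lemma crn_Suc: "i < length cs \<Longrightarrow> crn (Suc i) = corners (cs ! i)"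
  by (simp add: crn_def)

lemma crn_beyond: "length cs < i \<Longrightarrow> crn i = {}"
  by (simp add: crn_def)

lemma trn_Suc: "trn (Suc i) = of_bool (crn i \<inter> crn (i + 2) \<noteq> {})"
  by (simp add: trn_def)

lemma trn_le_1: "trn i \<le> 1"
  by (simp add: trn_def)

text \<open>Adjacent squares are consecutive in the list. Otherwise \<open>common_corner\<close>
  supplies a square adjacent to both, which must be the one in between.\<close>

lemma contact:
  assumes "v \<in> crn i" "v \<in> crn j" "i < j"
  shows "j = i + 1 \<or> j = i + 2 \<and> v \<in> crn (i + 1)"
proof -
  have i: "1 \<le> i" "i \<le> length cs" "1 \<le> j" "j \<le> length cs"
    using assms by (auto simp: crn_def split: if_splits)
  obtain i' j' where ij: "i = Suc i'" "j = Suc j'"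
    using i by (metis Suc_le_D One_nat_def)
  then have len: "i' < length cs" "j' < length cs" "i' < j'" using i assms by auto
  have "cs ! i' \<noteq> cs ! j'"
    using len dist nth_eq_iff_index_eq by fastforce
  then have "adjacent (cs ! i') (cs ! j') \<or>
      (\<exists>r\<in>set cs. adjacent (cs ! i') r \<and> adjacent r (cs ! j') \<and> v \<in> corners r)"
    using assms len diag diag' by (intro common_corner) (auto simp: ij crn_Suc)
  then show ?thesis
  proof
    assume "adjacent (cs ! i') (cs ! j')"
    then show ?thesis using adj[of i' j'] len by (auto simp: ij)
  next
    assume "\<exists>r\<in>set cs. adjacent (cs ! i') r \<and> adjacent r (cs ! j') \<and> v \<in> corners r"
    then obtain k where k: "k < length cs" "adjacent (cs ! i') (cs ! k)" "adjacent (cs ! k) (cs ! j')"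
        "v \<in> corners (cs ! k)"
      by (auto simp: in_set_conv_nth)
    then have "k = Suc i'" "j' = Suc k"
      using adj[of i' k] adj[of k j'] len by auto
    then show ?thesis using k by (auto simp: ij crn_Suc)
  qed
qed

text \<open>Counted from the smallest index at \<open>v\<close>, \<open>contact\<close> leaves room
  for at most three indices, so \<open>degree_eq_Suc_card\<close> applies.\<close>

lemma deg_eq:
  assumes "v \<in> crn i"
  shows "deg v = Suc (card {j. v \<in> crn j})"
proof -
  let ?J = "{j. v \<in> crn j}"
  have J: "?J \<subseteq> {1..length cs}"
    by (auto simp: crn_def split: if_splits)
  then have fin: "finite ?J" by (rule finite_subset) simp
  have "bij_betw (\<lambda>j. cs ! (j - 1)) ?J {c \<in> set cs. v \<in> corners c}"
  proof (rule bij_betw_imageI)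
    show "inj_on (\<lambda>j. cs ! (j - 1)) ?J"
    proof (rule inj_onI)
      fix j k assume "j \<in> ?J" "k \<in> ?J" "cs ! (j - 1) = cs ! (k - 1)"
      moreover from this have "1 \<le> j" "j \<le> length cs" "1 \<le> k" "k \<le> length cs"
        using J by auto
      moreover from this have "j - 1 < length cs" "k - 1 < length cs" by linarith+
      ultimately show "j = k"
        using nth_eq_iff_index_eq[OF dist, of "j - 1" "k - 1"] by simp
    qed
    show "(\<lambda>j. cs ! (j - 1)) ` ?J = {c \<in> set cs. v \<in> corners c}"
    proof (intro equalityI subsetI)
      fix c assume "c \<in> {c \<in> set cs. v \<in> corners c}"
      then obtain j where "j < length cs" "cs ! j = c" "v \<in> corners c"
        by (auto simp: in_set_conv_nth)
      then show "c \<in> (\<lambda>j. cs ! (j - 1)) ` ?J"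
        by (intro image_eqI[of _ _ "Suc j"]) (auto simp: crn_Suc)
    qed (auto simp: crn_def split: if_splits)
  qed
  then have card: "card ?J = card {c \<in> set cs. v \<in> corners c}"
    by (rule bij_betw_same_card)
  define m where "m = Min ?J"
  have m: "m \<in> ?J" "\<And>j. j \<in> ?J \<Longrightarrow> m \<le> j"
    using Min_in[OF fin] Min_le[OF fin] assms by (auto simp: m_def)
  have "?J \<subseteq> {m..m + 2}"
    using m contact[of v m] by (force simp: le_less)
  then have "card ?J \<le> card {m..m + 2}" by (intro card_mono) auto
  then have "card ?J \<le> 3" by simp
  moreover have "card ?J \<noteq> 0" using assms fin by auto
  ultimately show ?thesis
    unfolding card by (intro degree_eq_Suc_card diag diag') auto
qed

text \<open>By \<open>contact\<close>, an end of the side between squares \<open>i + 1\<close> and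
  \<open>i + 2\<close> can otherwise lie only in squares \<open>i\<close> and
  \<open>i + 3\<close>.\<close>

lemma deg_shared:
  assumes "v \<in> crn (Suc i)" "v \<in> crn (i + 2)"
  shows "deg v = 3 + of_bool (v \<in> crn i) + of_bool (v \<in> crn (i + 3))"
proof -
  have "{j. v \<in> crn j} = {Suc i, i + 2} \<union> (if v \<in> crn i then {i} else {})
      \<union> (if v \<in> crn (i + 3) then {i + 3} else {})"
  proof (intro equalityI subsetI)
    fix j assume j: "j \<in> {j. v \<in> crn j}"
    have "j \<in> {i, Suc i, i + 2, i + 3}"
      using contact[of v j "i + 2"] contact[of v "Suc i" j] j assms
      by (cases "j < Suc i"; cases "j = Suc i"; force)
    then show "j \<in> {Suc i, i + 2} \<union> (if v \<in> crn i then {i} else {})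
        \<union> (if v \<in> crn (i + 3) then {i + 3} else {})"
      using j by auto
  qed (use assms in \<open>auto split: if_splits\<close>)
  then show ?thesis
    unfolding deg_eq[OF assms(1)] by simp
qed

lemma single_index:
  assumes "v \<in> crn (Suc i)" "v \<notin> crn i" "v \<notin> crn (i + 2)" "v \<in> crn j"
  shows "j = Suc i"
proof (rule ccontr)
  assume "j \<noteq> Suc i"
  then consider "j < Suc i" | "Suc i < j" by linarith
  then show False
  proof cases
    case 1
    then have "j = i \<or> v \<in> crn i"
      using contact[OF assms(4,1)] by auto
    then show False using assms by blast
  next
    case 2
    then have "j = i + 2 \<or> v \<in> crn (i + 2)"
      using contact[OF assms(1,4)] by auto
    then show False using assms by blast
  qed
qed

lemma deg_single:
  assumes "v \<in> crn (Suc i)" "v \<notin> crn i" "v \<notin> crn (i + 2)"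
  shows "deg v = 2"
proof -
  have "{j. v \<in> crn j} = {Suc i}"
    using single_index[OF assms] assms(1) by blast
  then show ?thesis
    unfolding deg_eq[OF assms(1)] by simp
qed

text \<open>By \<open>three_cells\<close>, squares two places apart share one corner in a turn and
  none in a straight passage; by \<open>contact\<close>, that corner also lies in the middle
  square.\<close>

lemma card_triple:
  "card (crn i \<inter> crn (Suc i) \<inter> crn (i + 2)) = of_bool (crn i \<inter> crn (i + 2) \<noteq> {})"
proof -
  let ?X = "crn i \<inter> crn (Suc i) \<inter> crn (i + 2)"
  have "u = v" if uv: "u \<in> ?X" "v \<in> ?X" for u v
  proof -
    have len: "1 \<le> i" "i + 2 \<le> length cs"
      using uv by (auto simp: crn_def split: if_splits)
    then obtain k where k: "i = Suc k" "Suc (Suc k) < length cs" by (cases i) auto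
    have uv': "u \<in> corners (cs ! k) \<inter> corners (cs ! Suc (Suc k))"
        "v \<in> corners (cs ! k) \<inter> corners (cs ! Suc (Suc k))"
      using uv k by (simp_all add: crn_Suc)
    have "adjacent (cs ! k) (cs ! Suc k)" "adjacent (cs ! Suc k) (cs ! Suc (Suc k))"
        "cs ! k \<noteq> cs ! Suc (Suc k)"
      using adj dist k by (simp_all add: nth_eq_iff_index_eq)
    then show ?thesis
    proof (cases rule: three_cells)
      case (turn w p q r)
      then show ?thesis using uv' unfolding turn(5) by simp
    next
      case (straight a b a' b')
      then show ?thesis using uv' unfolding straight(5) by simp
    qed
  qed
  then have "card ?X = of_bool (?X \<noteq> {})" by (rule card_subsingleton)
  moreover have "?X = crn i \<inter> crn (i + 2)"
    using contact[of _ i "i + 2"] by auto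
  ultimately show ?thesis by simp
qed

text \<open>Both ends start from degree 3. The preceding square adds 1 at one of them exactly if
  square \<open>i + 1\<close> is a turn, the following square exactly if square \<open>i + 2\<close>
  is.\<close>

lemma sum_deg_shared:
  assumes "i + 1 < length cs"
  shows "(\<Sum>v\<in>crn (Suc i) \<inter> crn (i + 2). deg v) = 6 + trn (Suc i) + trn (i + 2)"
proof -
  let ?s = "crn (Suc i) \<inter> crn (i + 2)"
  have "adjacent (cs ! i) (cs ! Suc i)" using adj assms by simp
  then obtain a b a' b' where "distinct [a, b, a', b']" "corners (cs ! i) \<inter> corners (cs ! Suc i) = {a, b}"
    by (rule two_cells)
  then have s: "finite ?s" "card ?s = 2"
    using assms by (simp_all add: crn_Suc)
  have 1: "card {v \<in> ?s. v \<in> crn i} = trn (Suc i)"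
    unfolding trn_Suc card_triple[of i, symmetric] by (rule arg_cong[of _ _ card]) auto
  have 2: "card {v \<in> ?s. v \<in> crn (i + 3)} = trn (i + 2)"
  proof -
    have "trn (i + 2) = card (crn (Suc i) \<inter> crn (i + 2) \<inter> crn (i + 3))"
      using card_triple[of "Suc i"] trn_Suc[of "Suc i"] by (simp add: numeral_3_eq_3)
    moreover have "{v \<in> ?s. v \<in> crn (i + 3)} = crn (Suc i) \<inter> crn (i + 2) \<inter> crn (i + 3)"
      by auto
    ultimately show ?thesis by simp
  qed
  have "(\<Sum>v\<in>?s. deg v) = (\<Sum>v\<in>?s. 3 + of_bool (v \<in> crn i) + of_bool (v \<in> crn (i + 3)))"
    by (intro sum.cong refl deg_shared) auto
  also have "\<dots> = 6 + card {v \<in> ?s. v \<in> crn i} + card {v \<in> ?s. v \<in> crn (i + 3)}"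
    using s by (simp add: sum.distrib Int_def)
  finally show ?thesis unfolding 1 2 .
qed

end

section \<open>The index of a chain\<close>

text \<open>The index splits into contributions of the pairs of consecutive squares: the shared side,
  and for each of the two squares the outer edge that meets the other one.\<close>

definition pair_weight :: "real \<Rightarrow> nat \<Rightarrow> nat \<Rightarrow> real" where
  "pair_weight \<alpha> s t = (6 + real s + real t) powr \<alpha> + (6 + real s - real t) powr \<alpha>
     + (6 + real t - real s) powr \<alpha>"

text \<open>The pair of a terminal square and its neighbour. Compared with
  \<open>pair_weight \<alpha> 0 t\<close>, one \<open>6 + t\<close> drops to \<open>5 + t\<close>,
  because the outer edge of the terminal square has an end of degree 2. Its edges with sums 4 and 5
  are the same in every chain and are counted separately.\<close>

definition end_weight :: "real \<Rightarrow> nat \<Rightarrow> real" where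
  "end_weight \<alpha> t = (5 + real t) powr \<alpha> + (6 + real t) powr \<alpha> + (6 - real t) powr \<alpha>"

context cell_path
begin

context
  fixes \<alpha> :: real
begin

definition wt :: "(int \<times> int) set \<Rightarrow> real" where
  "wt e = real (\<Sum>v\<in>e. deg v) powr \<alpha>"

lemma wt_shared:
  assumes "i + 1 < length cs"
  shows "wt (crn (Suc i) \<inter> crn (i + 2)) = (6 + real (trn (Suc i)) + real (trn (i + 2))) powr \<alpha>"
  using sum_deg_shared[OF assms] by (simp add: wt_def)

lemma wt_doubleton: "u \<noteq> v \<Longrightarrow> wt {u, v} = (real (deg u) + real (deg v)) powr \<alpha>"
  by (simp add: wt_def)

lemma wt_eq:
  assumes "u \<noteq> v" "deg u + deg v = k"
  shows "wt {u, v} = real k powr \<alpha>"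
proof -
  have "(\<Sum>w\<in>{u, v}. deg w) = k" using assms by simp
  then show ?thesis unfolding wt_def by (rule arg_cong)
qed

text \<open>Serves both ends of the chain. The shared side has ends of degrees 3 and
  \<open>3 + t\<close>; which end is which does not affect the four sums taken together.\<close>

lemma sum_sides_end:
  assumes "adjacent c d"
    and two: "\<And>v. v \<in> corners c \<Longrightarrow> v \<notin> corners d \<Longrightarrow> deg v = 2"
    and three: "\<And>v. v \<in> corners c \<Longrightarrow> v \<in> corners d \<Longrightarrow> deg v \<ge> 3"
    and sum: "(\<Sum>v\<in>corners c \<inter> corners d. deg v) = 6 + t" and "t \<le> 1"
  shows "sum wt (sides c) = (6 + real t) powr \<alpha> + 4 powr \<alpha> + 5 powr \<alpha> + (5 + real t) powr \<alpha>"
  using assms(1)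
proof (rule two_cells)
  fix a b a' b'
  assume ab: "distinct [a, b, a', b']" "corners c = {a, b, a', b'}"
    "corners c \<inter> corners d = {a, b}" "sides c = {{a, b}, {a', b'}, {a, a'}, {b, b'}}"
  have "deg a + deg b = 6 + t" using sum ab by simp
  moreover have "deg a \<ge> 3" "deg b \<ge> 3" "deg a' = 2" "deg b' = 2"
  proof -
    have "a \<in> corners c \<inter> corners d" "b \<in> corners c \<inter> corners d"
      unfolding ab(3) by simp_all
    then show "deg a \<ge> 3" "deg b \<ge> 3" using three by simp_all
    have "a' \<in> corners c" "b' \<in> corners c" "a' \<notin> corners c \<inter> corners d" "b' \<notin> corners c \<inter> corners d"
      using ab(1,2) unfolding ab(3) by auto
    then show "deg a' = 2" "deg b' = 2" using two by simp_all
  qed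
  moreover from calculation \<open>t \<le> 1\<close> have "deg a = 3 \<and> deg b = 3 + t \<or> deg b = 3 \<and> deg a = 3 + t"
    by linarith
  ultimately show ?thesis
    unfolding ab(4) sum_four_cycle[OF ab(1)] using ab(1) by (auto simp: wt_doubleton add.commute)
qed

lemma sum_sides_first:
  assumes "2 \<le> length cs"
  shows "sum wt (sides (cs ! 0)) =
    (6 + real (trn 2)) powr \<alpha> + 4 powr \<alpha> + 5 powr \<alpha> + (5 + real (trn 2)) powr \<alpha>"
proof (rule sum_sides_end[of _ "cs ! 1"])
  have len: "0 < length cs" "1 < length cs" using assms by linarith+
  from len[THEN crn_Suc] have crn: "corners (cs ! 0) = crn (Suc 0)" "corners (cs ! Suc 0) = crn (Suc (Suc 0))"
    by simp_all
  show "adjacent (cs ! 0) (cs ! 1)" using adj[OF len] by simp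
  show "(\<Sum>v\<in>corners (cs ! 0) \<inter> corners (cs ! 1). deg v) = 6 + trn 2"
    using sum_deg_shared[of 0] assms by (simp add: crn trn_def[of "Suc 0"] numeral_2_eq_2)
  show "trn 2 \<le> 1" by (rule trn_le_1)
  fix v assume v: "v \<in> corners (cs ! 0)"
  show "deg v = 2" if "v \<notin> corners (cs ! 1)"
    using deg_single[of v 0] v that by (simp add: crn)
  show "deg v \<ge> 3" if "v \<in> corners (cs ! 1)"
    using deg_shared[of v 0] v that by (simp add: crn)
qed

lemma sum_sides_last:
  assumes n: "length cs = m + 2"
  shows "sum wt (sides (cs ! (m + 1))) =
    (6 + real (trn (m + 1))) powr \<alpha> + 4 powr \<alpha> + 5 powr \<alpha> + (5 + real (trn (m + 1))) powr \<alpha>"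
proof (rule sum_sides_end[of _ "cs ! m"])
  have crn: "corners (cs ! (m + 1)) = crn (m + 2)" "corners (cs ! m) = crn (Suc m)" "crn (m + 3) = {}"
    using n crn_Suc[of m] crn_Suc[of "m + 1"] crn_beyond[of "m + 3"] by (simp_all add: numeral_3_eq_3)
  then have t: "trn (m + 2) = 0" by (simp add: trn_def numeral_3_eq_3)
  show "adjacent (cs ! (m + 1)) (cs ! m)" using adj n by simp
  show "(\<Sum>v\<in>corners (cs ! (m + 1)) \<inter> corners (cs ! m). deg v) = 6 + trn (m + 1)"
    using sum_deg_shared[of m] n t unfolding crn by (simp add: Int_commute)
  show "trn (m + 1) \<le> 1" by (rule trn_le_1)
  fix v assume v: "v \<in> corners (cs ! (m + 1))"
  show "deg v = 2" if "v \<notin> corners (cs ! m)"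
    using deg_single[of v "Suc m"] v that crn by (simp add: numeral_3_eq_3)
  show "deg v \<ge> 3" if "v \<in> corners (cs ! m)"
    using deg_shared[of v m] v that crn by simp
qed

text \<open>For a straight square between two turns, either the two turns lie on opposite sides and
  both outer edges have degree sum 7, or they lie on the same side and the sums are 8 and 6; the
  last hypothesis excludes the second case.\<close>

lemma sum_sides_inner:
  assumes n: "i + 2 < length cs"
    and no_U: "crn (i + 1) \<inter> crn (i + 3) = {} \<Longrightarrow> trn (i + 1) = 1 \<Longrightarrow> trn (i + 3) = 1 \<Longrightarrow>
      \<forall>e\<in>sides (cs ! (i + 1)). \<exists>v\<in>e. deg v \<noteq> 3"
  shows "sum wt (sides (cs ! (i + 1))) =
    (6 + real (trn (i + 1)) + real (trn (i + 2))) powr \<alpha> +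
    (6 + real (trn (i + 2)) + real (trn (i + 3))) powr \<alpha> +
    (6 + real (trn (i + 1)) - real (trn (i + 2))) powr \<alpha> +
    (6 + real (trn (i + 3)) - real (trn (i + 2))) powr \<alpha>"
proof -
  let ?c = "cs ! i" and ?d = "cs ! (i + 1)" and ?e = "cs ! (i + 2)"
  have crn: "corners ?c = crn (Suc i)" "corners ?d = crn (i + 2)" "corners ?e = crn (i + 3)"
    using n crn_Suc[of i] crn_Suc[of "i + 1"] crn_Suc[of "i + 2"] by (simp_all add: numeral_3_eq_3)
  have sum1: "(\<Sum>v\<in>crn (Suc i) \<inter> crn (i + 2). deg v) = 6 + trn (i + 1) + trn (i + 2)"
    using sum_deg_shared[of i] n by simp
  have sum2: "(\<Sum>v\<in>crn (i + 2) \<inter> crn (i + 3). deg v) = 6 + trn (i + 2) + trn (i + 3)"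
    using sum_deg_shared[of "Suc i"] n by (simp add: numeral_3_eq_3)
  have deg1: "deg v = 3 + of_bool (v \<in> crn i) + of_bool (v \<in> crn (i + 3))"
    if "v \<in> crn (Suc i)" "v \<in> crn (i + 2)" for v
    using deg_shared that by blast
  have deg2: "deg v = 3 + of_bool (v \<in> crn (Suc i)) + of_bool (v \<in> crn (i + 4))"
    if "v \<in> crn (i + 2)" "v \<in> crn (i + 3)" for v
    using deg_shared[of v "Suc i"] that by (simp add: eval_nat_numeral)
  have t: "trn (i + 2) = of_bool (crn (Suc i) \<inter> crn (i + 3) \<noteq> {})"
    using trn_Suc[of "Suc i"] by (simp add: numeral_3_eq_3)
  have "adjacent ?c ?d" "adjacent ?d ?e" "?c \<noteq> ?e"
    using adj dist n by (simp_all add: nth_eq_iff_index_eq)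
  then show ?thesis
  proof (cases rule: three_cells)
    case (turn v p q r)
    note turn = turn[unfolded crn]
    have t1: "trn (i + 2) = 1" using turn t by simp
    have mem: "v \<in> crn (Suc i)" "v \<in> crn (i + 2)" "v \<in> crn (i + 3)" "r \<in> crn (i + 2)"
        "r \<notin> crn (Suc i)" "r \<notin> crn (i + 3)"
    proof -
      have "v \<in> crn (Suc i) \<inter> crn (i + 3)" "r \<in> crn (i + 2)" "v \<in> crn (i + 2)"
        unfolding turn(2,5) by simp_all
      moreover have "r \<notin> crn (Suc i) \<inter> crn (i + 2)" "r \<notin> crn (i + 2) \<inter> crn (i + 3)"
        using turn(1) unfolding turn(3,4) by auto
      ultimately show "v \<in> crn (Suc i)" "v \<in> crn (i + 2)" "v \<in> crn (i + 3)" "r \<in> crn (i + 2)"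
        "r \<notin> crn (Suc i)" "r \<notin> crn (i + 3)" by blast+
    qed
    \<comment> \<open>\<open>v\<close> lies in the squares \<open>i + 1\<close>,
      \<open>i + 2\<close>, \<open>i + 3\<close>; \<open>contact\<close> keeps it out of square
      \<open>i\<close>, three places before the last of these.\<close>
    have "deg v = 4"
      using deg1 mem contact[of v i "i + 3"] by auto
    moreover have "deg v + deg p = 7 + trn (i + 1)" "deg v + deg q = 7 + trn (i + 3)"
      using sum1 sum2 turn t1 by simp_all
    moreover have "deg r = 2"
      using deg_single[of r "Suc i"] mem by (simp add: numeral_3_eq_3)
    ultimately have "deg v = 4" "deg p = 3 + trn (i + 1)" "deg q = 3 + trn (i + 3)" "deg r = 2"
      by linarith+
    moreover have "sides ?d = {{v, p}, {q, r}, {v, q}, {p, r}}"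
      unfolding turn(6) by auto
    moreover have "distinct [v, p, q, r]" by fact
    ultimately show ?thesis
      by (simp only: sum_four_cycle) (simp add: wt_doubleton t1[simplified] add.commute add.left_commute)
  next
    case (straight a b a' b')
    note straight = straight[unfolded crn]
    have t0: "trn (i + 2) = 0" using straight t by simp
    have mem: "a \<in> crn (Suc i)" "b \<in> crn (Suc i)" "a \<in> crn (i + 2)" "b \<in> crn (i + 2)"
        "a' \<in> crn (i + 3)" "b' \<in> crn (i + 3)" "a' \<in> crn (i + 2)" "b' \<in> crn (i + 2)"
      using straight(2-4) by blast+
    have ge3: "deg a \<ge> 3" "deg b \<ge> 3" "deg a' \<ge> 3" "deg b' \<ge> 3"
      using deg1 deg2 mem by simp_all
    have sums: "deg a + deg b = 6 + trn (i + 1)" "deg a' + deg b' = 6 + trn (i + 3)"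
      using sum1 sum2 straight t0 by simp_all
    have le: "trn (i + 1) \<le> 1" "trn (i + 3) \<le> 1" by (rule trn_le_1)+
    have no: "\<not> (deg a = 3 \<and> deg a' = 3)" "\<not> (deg b = 3 \<and> deg b' = 3)"
      if "trn (i + 1) = 1" "trn (i + 3) = 1"
      using no_U that straight by auto
    \<comment> \<open>The sums of the two outer edges are known only as an unordered pair: 6 and 6,
      6 and 7, or 7 and 7, the combination 6 and 8 being excluded by \<open>no\<close>.\<close>
    have "{deg a + deg a', deg b + deg b'} = {6 + trn (i + 1), 6 + trn (i + 3)} \<and>
        deg a + deg a' + (deg b + deg b') = 12 + trn (i + 1) + trn (i + 3)"
    proof -
      have "trn (i + 1) = 0 \<or> trn (i + 1) = 1" "trn (i + 3) = 0 \<or> trn (i + 3) = 1"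
        using le by linarith+
      moreover have "deg a = 3 \<and> deg b = 3 + trn (i + 1) \<or> deg b = 3 \<and> deg a = 3 + trn (i + 1)"
        "deg a' = 3 \<and> deg b' = 3 + trn (i + 3) \<or> deg b' = 3 \<and> deg a' = 3 + trn (i + 3)"
        using sums ge3 le by linarith+
      ultimately show ?thesis using no by auto
    qed
    then have "deg a + deg a' = 6 + trn (i + 1) \<and> deg b + deg b' = 6 + trn (i + 3) \<or>
        deg a + deg a' = 6 + trn (i + 3) \<and> deg b + deg b' = 6 + trn (i + 1)"
      by (auto simp: doubleton_eq_iff)
    then have "wt {a, a'} + wt {b, b'} = (6 + real (trn (i + 1))) powr \<alpha> + (6 + real (trn (i + 3))) powr \<alpha>"
      using straight(1) by (elim disjE conjE) (simp_all add: wt_eq)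
    moreover have "wt {a, b} = (6 + real (trn (i + 1))) powr \<alpha>"
      "wt {a', b'} = (6 + real (trn (i + 3))) powr \<alpha>"
      using sums straight(1) by (simp_all add: wt_eq)
    ultimately show ?thesis
      unfolding straight(6) sum_four_cycle[OF straight(1)] t0 by simp
  qed
qed

text \<open>Inclusion and exclusion: each new square has exactly one side in common with the union
  of its predecessors, the one shared with the square just before it.\<close>

lemma sum_sides_Union:
  assumes "Suc k \<le> length cs"
  shows "sum wt (\<Union>i<Suc k. sides (cs ! i)) =
    (\<Sum>i<Suc k. sum wt (sides (cs ! i))) - (\<Sum>i<k. wt (crn (Suc i) \<inter> crn (i + 2)))"
  using assms
proof (induction k)
  case 0
  then show ?case by (simp add: lessThan_Suc)
next
  case (Suc k)
  let ?A = "\<Union>i<Suc k. sides (cs ! i)" and ?B = "sides (cs ! Suc k)"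
  have fin: "finite (sides c)" for c by (cases c) (simp add: sides.simps)
  have "sides (cs ! i) \<inter> ?B = {}" if "i < k" for i
  proof -
    have "\<not> adjacent (cs ! i) (cs ! Suc k)" "cs ! i \<noteq> cs ! Suc k"
      using adj dist that Suc.prems by (auto simp: nth_eq_iff_index_eq)
    then show ?thesis by (simp add: adjacent_def)
  qed
  then have "?A \<inter> ?B = sides (cs ! k) \<inter> ?B"
    by (auto simp: lessThan_Suc)
  also have "\<dots> = {crn (Suc k) \<inter> crn (k + 2)}"
    using sides_Int_adjacent[of "cs ! k" "cs ! Suc k"] adj Suc.prems by (simp add: crn_Suc)
  finally have "sum wt (?A \<union> ?B) = sum wt ?A + sum wt ?B - wt (crn (Suc k) \<inter> crn (k + 2))"
    using fin by (subst sum_Un) auto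
  moreover have "(\<Union>i<Suc (Suc k). sides (cs ! i)) = ?A \<union> ?B"
    by (auto simp: less_Suc_eq)
  ultimately show ?case
    using Suc by simp
qed

lemma sum_connectivity_cell_path:
  assumes n: "length cs = m + 3"
    and no_U: "\<And>i. i + 2 < length cs \<Longrightarrow> crn (i + 1) \<inter> crn (i + 3) = {} \<Longrightarrow> trn (i + 1) = 1 \<Longrightarrow>
      trn (i + 3) = 1 \<Longrightarrow> \<forall>e\<in>sides (cs ! (i + 1)). \<exists>v\<in>e. deg v \<noteq> 3"
  shows "sum_connectivity \<alpha> (cell_graph (set cs)) =
    2 * 4 powr \<alpha> + 2 * 5 powr \<alpha> + end_weight \<alpha> (trn 2) + end_weight \<alpha> (trn (m + 2)) +
    (\<Sum>j<m. pair_weight \<alpha> (trn (j + 2)) (trn (j + 3)))"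
proof -
  let ?p = "\<lambda>x :: real. x powr \<alpha>"
  define T where "T j = real (trn j)" for j
  \<comment> \<open>For the pair of squares \<open>j + 1\<close> and \<open>j + 2\<close>,
    \<open>s j\<close> belongs to the shared side, \<open>u j\<close> to an outer edge of square
    \<open>j + 1\<close> and \<open>d j\<close> to an outer edge of square
    \<open>j + 2\<close>.\<close>
  define s where "s j = ?p (6 + T (j + 1) + T (j + 2))" for j
  define u where "u j = ?p (6 + T (j + 2) - T (j + 1))" for j
  define d where "d j = ?p (6 + T (j + 1) - T (j + 2))" for j
  have "edges (cell_graph (set cs)) = (\<Union>i<m + 3. sides (cs ! i))"
  proof -
    have "set cs = (!) cs ` {..<m + 3}" using n by (auto simp: set_conv_nth)
    then show ?thesis by (simp add: edges_def cell_graph_def)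
  qed
  then have "sum_connectivity \<alpha> (cell_graph (set cs)) = sum wt (\<Union>i<Suc (m + 2). sides (cs ! i))"
    by (simp add: sum_connectivity_def wt_def numeral_3_eq_3)
  also have "\<dots> = (\<Sum>i<Suc (m + 2). sum wt (sides (cs ! i))) - (\<Sum>i<m + 2. s i)"
  proof -
    have "(\<Sum>i<m + 2. wt (crn (Suc i) \<inter> crn (i + 2))) = (\<Sum>i<m + 2. s i)"
      using wt_shared n by (intro sum.cong) (simp_all add: s_def T_def)
    then show ?thesis using sum_sides_Union[of "m + 2"] n by simp
  qed
  also have "(\<Sum>i<Suc (m + 2). sum wt (sides (cs ! i))) =
      sum wt (sides (cs ! 0)) + (\<Sum>i<m + 1. sum wt (sides (cs ! (i + 1)))) + sum wt (sides (cs ! (m + 2)))"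
    using sum.lessThan_Suc_shift[of "\<lambda>i. sum wt (sides (cs ! i))" "m + 1"] by simp
  also have "sum wt (sides (cs ! 0)) = s 0 + 4 powr \<alpha> + 5 powr \<alpha> + ?p (5 + T 2)"
    using sum_sides_first n by (simp add: s_def T_def trn_def[of "Suc 0"] numeral_2_eq_2)
  also have "sum wt (sides (cs ! (m + 2))) = s (m + 1) + 4 powr \<alpha> + 5 powr \<alpha> + ?p (5 + T (m + 2))"
  proof -
    have "trn (m + 3) = 0" using crn_beyond[of "m + 4"] n by (simp add: trn_def eval_nat_numeral)
    then show ?thesis
      using sum_sides_last[of "m + 1"] n by (simp add: s_def T_def eval_nat_numeral)
  qed
  also have "(\<Sum>i<m + 1. sum wt (sides (cs ! (i + 1)))) = (\<Sum>i<m + 1. s i + s (i + 1) + d i + u (i + 1))"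
  proof (rule sum.cong[OF refl])
    fix i assume "i \<in> {..<m + 1}"
    then show "sum wt (sides (cs ! (i + 1))) = s i + s (i + 1) + d i + u (i + 1)"
      using sum_sides_inner[of i] no_U[of i] n
      by (simp add: s_def d_def u_def T_def eval_nat_numeral)
  qed
  finally have eq: "sum_connectivity \<alpha> (cell_graph (set cs)) =
      s 0 + 4 powr \<alpha> + 5 powr \<alpha> + ?p (5 + T 2) + (\<Sum>i<m + 1. s i + s (i + 1) + d i + u (i + 1)) +
      (s (m + 1) + 4 powr \<alpha> + 5 powr \<alpha> + ?p (5 + T (m + 2))) - (\<Sum>i<m + 2. s i)" .
  \<comment> \<open>Each shared side was counted in two squares and subtracted once. Splitting off
    the two end pairs leaves the \<open>m\<close> pairs of inner squares.\<close>
  have "(\<Sum>i<m + 2. s i) = s 0 + (\<Sum>i<m. s (i + 1)) + s (m + 1)"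
      "(\<Sum>i<m + 1. s i) = s 0 + (\<Sum>i<m. s (i + 1))" "(\<Sum>i<m + 1. d i) = d 0 + (\<Sum>i<m. d (i + 1))"
      "(\<Sum>i<m + 1. s (i + 1)) = (\<Sum>i<m. s (i + 1)) + s (m + 1)"
      "(\<Sum>i<m + 1. u (i + 1)) = (\<Sum>i<m. u (i + 1)) + u (m + 1)"
    using sum.lessThan_Suc_shift[of s m] sum.lessThan_Suc_shift[of d m] by simp_all
  with eq have "sum_connectivity \<alpha> (cell_graph (set cs)) = 2 * 4 powr \<alpha> + 2 * 5 powr \<alpha> +
      (?p (5 + T 2) + s 0 + d 0) + (?p (5 + T (m + 2)) + s (m + 1) + u (m + 1)) +
      (\<Sum>i<m. s (i + 1) + d (i + 1) + u (i + 1))"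
    by (simp add: sum.distrib)
  moreover have "?p (5 + T 2) + s 0 + d 0 = end_weight \<alpha> (trn 2)"
    by (simp add: end_weight_def s_def d_def T_def trn_def[of "Suc 0"] numeral_2_eq_2)
  moreover have "?p (5 + T (m + 2)) + s (m + 1) + u (m + 1) = end_weight \<alpha> (trn (m + 2))"
  proof -
    have "trn (m + 3) = 0" using crn_beyond[of "m + 4"] n by (simp add: trn_def eval_nat_numeral)
    then show ?thesis
      by (simp add: end_weight_def s_def u_def T_def eval_nat_numeral)
  qed
  moreover have "(\<Sum>i<m. s (i + 1) + d (i + 1) + u (i + 1)) =
      (\<Sum>j<m. pair_weight \<alpha> (trn (j + 2)) (trn (j + 3)))"
    by (simp add: pair_weight_def s_def u_def d_def T_def eval_nat_numeral)
  ultimately show ?thesis by simp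
qed

end

end

section \<open>Straight triples and chains\<close>

lemma degree_ge_3:
  assumes "v \<in> corners p" "v \<in> corners q" "p \<noteq> q" "p \<in> S" "q \<in> S"
  shows "degree (cell_graph S) v \<ge> 3"
proof -
  obtain x y where v: "v = (x, y)" by force
  have "p \<in> {(x, y), (x - 1, y), (x - 1, y - 1), (x, y - 1)}"
    and "q \<in> {(x, y), (x - 1, y), (x - 1, y - 1), (x, y - 1)}"
    using assms(1,2) unfolding v mem_corners_iff by auto
  then show ?thesis
    using assms(3-5) unfolding v degree_quadrants by (elim insertE emptyE) simp_all
qed

lemma degree_eq_2:
  assumes "v \<in> corners p" "p \<in> S" "\<And>q. q \<in> S \<Longrightarrow> v \<in> corners q \<Longrightarrow> q = p"
  shows "degree (cell_graph S) v = 2"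
proof -
  obtain x y where v: "v = (x, y)" by force
  have "p \<in> {(x, y), (x - 1, y), (x - 1, y - 1), (x, y - 1)}"
    using assms(1) unfolding v mem_corners_iff by auto
  moreover have "q \<in> S \<longleftrightarrow> q = p" if "q \<in> {(x, y), (x - 1, y), (x - 1, y - 1), (x, y - 1)}" for q
    using assms that unfolding v mem_corners_iff by blast
  note this[of "(x, y)"] this[of "(x - 1, y)"] this[of "(x - 1, y - 1)"] this[of "(x, y - 1)"]
  ultimately show ?thesis
    unfolding v degree_quadrants by (elim insertE emptyE) simp_all
qed

text \<open>The complement of a bounded convex set in the plane is connected, so it is the only
  region besides the open squares.\<close>

lemma polyomino_system_convex:
  assumes S: "finite S" "S \<noteq> {}"
    and connected: "\<forall>c\<in>S. \<forall>d\<in>S. (c, d) \<in> {(a, b). a \<in> S \<and> b \<in> S \<and> adjacent a b}\<^sup>*"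
    and conv: "convex (\<Union>c\<in>S. unit_square c)"
  shows "polyomino_system S"
proof -
  let ?K = "\<Union>c\<in>S. unit_square c"
  let ?I = "\<lambda>c. interior (unit_square c)"
  have cpt: "compact (unit_square c)" and cnv: "convex (unit_square c)" for c
    by (cases c; simp only: unit_square.simps compact_cbox convex_box)+
  have K: "compact ?K" using S(1) cpt by (intro compact_UN) auto
  then have "open (- ?K)" "bounded ?K"
    using compact_imp_closed open_Compl compact_imp_bounded by blast+
  have unb: "\<not> bounded (- ?K)"
    using \<open>bounded ?K\<close> cobounded_imp_unbounded[of "- ?K"] by auto
  have "?I c \<noteq> {}" for c
  proof (cases c)
    case (Pair x y)
    have "Complex (of_int x + 1 / 2) (of_int y + 1 / 2) \<in> ?I (x, y)"
      by (simp only: mem_interior_unit_square) simp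
    then show ?thesis unfolding Pair by blast
  qed
  moreover have "connected (- ?K)"
    using \<open>bounded ?K\<close> conv by (intro connected_complement_bounded_convex) auto
  moreover have "- ?K \<noteq> {}" using unb by auto
  moreover have "pairwise disjnt (insert (- ?K) (?I ` S))"
  proof -
    have outer: "disjnt (?I c) (- ?K)" if "c \<in> S" for c
      using that interior_subset unfolding disjnt_def by fastforce
    have inner: "disjnt (?I c) (?I d)" if "c \<noteq> d" for c d
      using that interior_unit_square_disjoint[of _ c d] interior_subset unfolding disjnt_def by blast
    show ?thesis
    proof (rule pairwiseI)
      fix X Y assume "X \<in> insert (- ?K) (?I ` S)" "Y \<in> insert (- ?K) (?I ` S)" "X \<noteq> Y"
      then show "disjnt X Y"
        by (elim insertE imageE) (metis outer inner disjnt_sym)+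
    qed
  qed
  ultimately have comps: "components (- figure S) = insert (- ?K) (?I ` S)"
    using \<open>open (- ?K)\<close> cnv
    by (intro components_open_unique)
      (auto simp: compl_figure simp del: unit_square.simps intro!: convex_connected convex_interior)
  have "bounded (?I c)" for c
    using cpt bounded_subset[OF compact_imp_bounded interior_subset] by blast
  then show ?thesis
    unfolding polyomino_system_def comps using S connected unb by (auto simp del: unit_square.simps)
qed

lemma straight_three_cells:
  assumes "adjacent c d" "adjacent d e" "corners c \<inter> corners e = {}"
  obtains x y where "{c, d, e} = {(x - 1, y), (x, y), (x + 1, y)}"
  | x y where "{c, d, e} = {(x, y - 1), (x, y), (x, y + 1)}"
proof -
  obtain x y where d: "d = (x, y)" by force
  have "c \<in> {(x - 1, y), (x + 1, y), (x, y - 1), (x, y + 1)}"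
    using assms(1) by (cases c) (auto simp: d adjacent_iff)
  moreover have "e \<in> {(x - 1, y), (x + 1, y), (x, y - 1), (x, y + 1)}"
    using assms(2) by (cases e) (auto simp: d adjacent_iff)
  ultimately show thesis
    using assms(3) that(1)[of x y] that(2)[of x y]
    by (elim insertE emptyE) (simp_all add: d corners.simps insert_commute)
qed

lemma adjacent_corners: "adjacent c d \<Longrightarrow> corners c \<inter> corners d \<noteq> {}"
  by (elim two_cells) auto

text \<open>A segment must be a polyomino chain in its own right, including the condition on
  regions. A straight triple fills a rectangle, which is convex, and every corner of its middle
  square lies in an end square, so there is no kink.\<close>

lemma linear_chain_three:
  assumes cd: "adjacent c d" and de: "adjacent d e" and disj: "corners c \<inter> corners e = {}"
  shows "linear_chain {c, d, e}"
proof -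
  let ?T = "{c, d, e}"
  have "\<not> adjacent c e" using disj adjacent_corners by blast
  moreover have "c \<noteq> e" using disj cd adjacent_corners by blast
  moreover have "\<not> adjacent a a" "adjacent a b \<longleftrightarrow> adjacent b a" for a b
    by (auto simp: adjacent_def)
  ultimately have adj: "\<not> adjacent c e" "\<not> adjacent e c" "c \<noteq> e" "c \<noteq> d" "d \<noteq> e" "adjacent d c"
      "adjacent e d" "\<not> adjacent a a" for a
    using cd de by (blast, blast, blast, metis, metis, blast, blast, blast)
  have nb: "neighbours ?T c = {d}" "neighbours ?T d = {c, e}" "neighbours ?T e = {d}"
    using cd de adj by (auto simp: neighbours_def)
  have "convex (\<Union>c\<in>?T. unit_square c)"
    using assms
  proof (rule straight_three_cells)
    fix x y assume eq: "?T = {(x - 1, y), (x, y), (x + 1, y)}"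
    have "(\<Union>c\<in>?T. unit_square c) =
        cbox (Complex (of_int x - 1) (of_int y)) (Complex (of_int x + 2) (of_int y + 1))"
      unfolding eq by (auto simp: mem_unit_square in_cbox_complex_iff simp del: unit_square.simps)
    then show ?thesis by (simp only: convex_box)
  next
    fix x y assume eq: "?T = {(x, y - 1), (x, y), (x, y + 1)}"
    have "(\<Union>c\<in>?T. unit_square c) =
        cbox (Complex (of_int x) (of_int y - 1)) (Complex (of_int x + 1) (of_int y + 2))"
      unfolding eq by (auto simp: mem_unit_square in_cbox_complex_iff simp del: unit_square.simps)
    then show ?thesis by (simp only: convex_box)
  qed
  moreover have "\<forall>a\<in>?T. \<forall>b\<in>?T. (a, b) \<in> {(a, b). a \<in> ?T \<and> b \<in> ?T \<and> adjacent a b}\<^sup>*" (is "\<forall>a\<in>?T. \<forall>b\<in>?T. _ \<in> ?r\<^sup>*")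
  proof -
    have r: "(c, d) \<in> ?r\<^sup>*" "(d, c) \<in> ?r\<^sup>*" "(d, e) \<in> ?r\<^sup>*" "(e, d) \<in> ?r\<^sup>*"
      using cd de adj by (auto intro!: r_into_rtrancl)
    then have "(a, d) \<in> ?r\<^sup>*" "(d, a) \<in> ?r\<^sup>*" if "a \<in> ?T" for a
      using that by blast+
    then show ?thesis by (meson rtrancl_trans)
  qed
  ultimately have "polyomino_system ?T"
    by (intro polyomino_system_convex) simp_all
  moreover have "\<forall>i<length [c, d, e]. \<forall>j<length [c, d, e].
      adjacent ([c, d, e] ! i) ([c, d, e] ! j) \<longleftrightarrow> i = Suc j \<or> j = Suc i"
    using cd de adj by (auto simp: less_Suc_eq)
  moreover from this have "\<exists>cs. distinct cs \<and> set cs = ?T \<and> (\<forall>i<length cs. \<forall>j<length cs.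
      adjacent (cs ! i) (cs ! j) \<longleftrightarrow> i = Suc j \<or> j = Suc i)"
    using adj by (intro exI[of _ "[c, d, e]"] conjI) simp_all
  ultimately have "polyomino_chain ?T"
    unfolding polyomino_chain_def using nb adj by (simp add: card_insert_if)
  moreover have "\<not> kink ?T a" if "a \<in> ?T" for a
  proof
    assume kink: "kink ?T a"
    then have "a = d"
      using that nb by (auto simp: kink_def non_terminal_def)
    have "corners d \<subseteq> corners c \<union> corners e"
      using cd de \<open>c \<noteq> e\<close>
    proof (cases rule: three_cells)
      case (turn v p q r)
      then show ?thesis using disj by simp
    next
      case (straight a b a' b')
      then show ?thesis by blast
    qed
    then have "degree (cell_graph ?T) v \<ge> 3" if "v \<in> corners d" for v
      using that degree_ge_3[of v d c ?T] degree_ge_3[of v d e ?T] adj by auto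
    then show False
      using kink \<open>a = d\<close> by (fastforce simp: kink_def)
  qed
  ultimately show ?thesis
    by (simp add: linear_chain_def)
qed

text \<open>Following the list forwards or backwards gives the walks that
  \<open>no_diagonal_contact\<close> requires.\<close>

lemma cell_path_of_chain:
  assumes "polyomino_chain S"
  obtains cs where "cell_path cs" "set cs = S"
proof -
  obtain cs where cs: "distinct cs" "set cs = S"
    and adj: "\<And>i j. i < length cs \<Longrightarrow> j < length cs \<Longrightarrow>
      adjacent (cs ! i) (cs ! j) \<longleftrightarrow> i = Suc j \<or> j = Suc i"
    using assms unfolding polyomino_chain_def by blast
  have out: "connected_outside S"
    using assms by (simp add: polyomino_chain_def connected_outside_polyomino_system)
  have walk: "\<exists>P m. P 0 = c \<and> P m = d \<and> (\<forall>k<m. adjacent (P k) (P (Suc k))) \<and> (\<forall>k\<le>m. P k \<in> S)"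
    if mem: "c \<in> S" "d \<in> S" for c d
  proof -
    obtain i j where ij: "i < length cs" "c = cs ! i" "j < length cs" "d = cs ! j"
      using mem unfolding cs(2)[symmetric] in_set_conv_nth by blast
    show ?thesis
    proof (cases "i \<le> j")
      case True
      with ij cs(2)[symmetric] show ?thesis
        by (intro exI[of _ "\<lambda>k. cs ! (i + k)"] exI[of _ "j - i"]) (auto simp: adj)
    next
      case False
      with ij cs(2)[symmetric] show ?thesis
        by (intro exI[of _ "\<lambda>k. cs ! (i - k)"] exI[of _ "i - j"]) (auto simp: adj)
    qed
  qed
  have "cell_path cs"
  proof (unfold_locales, unfold cs(2))
    fix x y assume "(x, y) \<in> S" "(x + 1, y + 1) \<in> S"
    from walk[OF this] obtain P m where "P 0 = (x, y)" "P m = (x + 1, y + 1)"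
        "\<And>k. k < m \<Longrightarrow> adjacent (P k) (P (Suc k))" "\<And>k. k \<le> m \<Longrightarrow> P k \<in> S"
      by blast
    then show "(x + 1, y) \<in> S \<or> (x, y + 1) \<in> S"
      by (rule no_diagonal_contact[OF out])
  next
    fix x y assume "(x + 1, y) \<in> S" "(x, y + 1) \<in> S"
    from walk[OF this] obtain P m where P: "P 0 = (x + 1, y)" "P m = (x, y + 1)"
        "\<And>k. k < m \<Longrightarrow> adjacent (P k) (P (Suc k))" "\<And>k. k \<le> m \<Longrightarrow> P k \<in> S"
      by blast
    \<comment> \<open>A reflection of the lattice of cells, which exchanges the two diagonal
      directions.\<close>
    let ?f = "\<lambda>(x, y). (- x, y) :: cell"
    have adj: "adjacent (?f p) (?f q) \<longleftrightarrow> adjacent p q" for p q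
      by (cases p; cases q; simp add: adjacent_iff; arith)
    have mem: "?f p \<in> {(x, y). (- x, y) \<in> S} \<longleftrightarrow> p \<in> S" for p
      by (cases p) simp
    have "(- (x + 1) + 1, y) \<in> {(x, y). (- x, y) \<in> S} \<or> (- (x + 1), y + 1) \<in> {(x, y). (- x, y) \<in> S}"
    proof (rule no_diagonal_contact[OF connected_outside_mirror[OF out], of "\<lambda>k. ?f (P k)" _ _ m])
      show "?f (P 0) = (- (x + 1), y)" "?f (P m) = (- (x + 1) + 1, y + 1)"
        using P by simp_all
      show "adjacent (?f (P k)) (?f (P (Suc k)))" if "k < m" for k
        unfolding adj using P that by blast
      show "?f (P k) \<in> {(x, y). (- x, y) \<in> S}" if "k \<le> m" for k
        unfolding mem using P that by blast
    qed
    then show "(x, y) \<in> S \<or> (x + 1, y + 1) \<in> S" by (simp add: add.commute)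
  qed (use cs adj in auto)
  then show thesis using cs(2) that by blast
qed

section \<open>Kinks and internal segments\<close>

context cell_path
begin

lemma trn_inner:
  assumes "i + 2 < length cs"
  shows "trn (i + 2) = of_bool (corners (cs ! i) \<inter> corners (cs ! (i + 2)) \<noteq> {})"
  using trn_Suc[of "Suc i"] crn_Suc[of i] crn_Suc[of "i + 2"] assms by (simp add: numeral_3_eq_3)

lemma trn_Suc_eq_1: "trn (Suc i) = 1 \<longleftrightarrow> crn i \<inter> crn (i + 2) \<noteq> {}"
  by (cases "crn i \<inter> crn (i + 2) = {}") (simp_all add: trn_Suc)

lemma consecutive_cells:
  assumes "i + 2 < length cs"
  shows "adjacent (cs ! i) (cs ! (i + 1))" "adjacent (cs ! (i + 1)) (cs ! (i + 2))"
    "cs ! i \<noteq> cs ! (i + 2)"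
  using assms adj dist by (simp_all add: nth_eq_iff_index_eq)

lemma neighbours_inner:
  assumes i: "i + 2 < length cs" and S: "S \<subseteq> set cs" "cs ! i \<in> S" "cs ! (i + 2) \<in> S"
  shows "neighbours S (cs ! (i + 1)) = {cs ! i, cs ! (i + 2)}"
proof (intro equalityI subsetI)
  fix d assume "d \<in> neighbours S (cs ! (i + 1))"
  then have d: "d \<in> set cs" "adjacent (cs ! (i + 1)) d"
    using S by (auto simp: neighbours_def)
  then obtain k where k: "k < length cs" "d = cs ! k"
    by (metis in_set_conv_nth)
  then have "k = i \<or> k = i + 2" using d adj[of "i + 1" k] i by auto
  then show "d \<in> {cs ! i, cs ! (i + 2)}" using k by auto
next
  fix d assume "d \<in> {cs ! i, cs ! (i + 2)}"
  then show "d \<in> neighbours S (cs ! (i + 1))"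
    using consecutive_cells[OF i] S by (auto simp: neighbours_def adjacent_sym[of "cs ! i"])
qed

lemma card_neighbours_inner:
  assumes "i + 2 < length cs" "S \<subseteq> set cs" "cs ! i \<in> S" "cs ! (i + 2) \<in> S"
  shows "card (neighbours S (cs ! (i + 1))) = 2"
  unfolding neighbours_inner[OF assms] using consecutive_cells(3)[OF assms(1)] by simp

text \<open>In a turn, the corner opposite to the common one lies in no other square; in a straight
  passage, every corner lies in a neighbouring square. The statement allows subsets \<open>S\<close>
  because it is applied both to the chain and to linear chains extending a triple. The square
  \<open>cs ! (i + 1)\<close> has number \<open>i + 2\<close>.\<close>

lemma kink_inner:
  assumes i: "i + 2 < length cs"
    and S: "S \<subseteq> set cs" "cs ! i \<in> S" "cs ! (i + 1) \<in> S" "cs ! (i + 2) \<in> S"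
  shows "kink S (cs ! (i + 1)) \<longleftrightarrow> trn (i + 2) = 1"
proof -
  have nt: "non_terminal S (cs ! (i + 1))"
    using card_neighbours_inner[OF i] S by (simp add: non_terminal_def)
  have crn: "corners (cs ! i) = crn (Suc i)" "corners (cs ! (i + 1)) = crn (Suc (Suc i))"
      "corners (cs ! (i + 2)) = crn (Suc i + 2)"
    using i crn_Suc[of i] crn_Suc[of "i + 1"] crn_Suc[of "i + 2"] by simp_all
  from consecutive_cells[OF i] show ?thesis
  proof (cases rule: three_cells)
    case (turn v p q r)
    have r: "r \<in> corners (cs ! (i + 1))" "r \<notin> corners (cs ! i)" "r \<notin> corners (cs ! (i + 2))"
      using turn(1,2) turn(3)[THEN equalityD1] turn(4)[THEN equalityD1] by auto
    note r' = r[unfolded crn]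
    have "d = cs ! (i + 1)" if d: "d \<in> S" "r \<in> corners d" for d
    proof -
      obtain k where k: "k < length cs" "d = cs ! k"
        using d(1) S(1) by (metis in_set_conv_nth subsetD)
      then show ?thesis
        using single_index[OF r', of "Suc k"] d(2) by (simp add: crn_Suc)
    qed
    then have "degree (cell_graph S) r = 2"
      by (rule degree_eq_2[OF r(1) S(3)])
    then have "kink S (cs ! (i + 1))" using nt r(1) unfolding kink_def by blast
    then show ?thesis using trn_inner[OF i] turn(5) by simp
  next
    case (straight a b a' b')
    have ne: "cs ! (i + 1) \<noteq> cs ! i" "cs ! (i + 1) \<noteq> cs ! (i + 2)"
      using i dist by (simp_all add: nth_eq_iff_index_eq)
    have "degree (cell_graph S) v \<noteq> 2" if v: "v \<in> corners (cs ! (i + 1))" for v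
    proof -
      have "v \<in> corners (cs ! i) \<inter> corners (cs ! (i + 1)) \<or> v \<in> corners (cs ! (i + 1)) \<inter> corners (cs ! (i + 2))"
      proof -
        have "v \<in> {a, b} \<or> v \<in> {a', b'}" using v unfolding straight(2) by auto
        then show ?thesis unfolding straight(3,4) .
      qed
      then have "degree (cell_graph S) v \<ge> 3"
        using degree_ge_3[OF v _ ne(1) S(3,2)] degree_ge_3[OF v _ ne(2) S(3,4)] by auto
      then show ?thesis by linarith
    qed
    then have "\<not> kink S (cs ! (i + 1))"
      unfolding kink_def by blast
    then show ?thesis using trn_inner[OF i] straight(5) by simp
  qed
qed

lemma not_terminal_inner:
  assumes "i + 2 < length cs"
  shows "\<not> terminal (set cs) (cs ! (i + 1))"
  using card_neighbours_inner[OF assms subset_refl] assms by (simp add: terminal_def)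

lemma zigzag_turns:
  assumes "zigzag_chain n (set cs)" "i + 2 < length cs"
  shows "trn (i + 2) = 1"
proof -
  have "kink (set cs) (cs ! (i + 1))"
    using assms not_terminal_inner[of i] by (auto simp: zigzag_chain_def)
  then show ?thesis using kink_inner[OF assms(2) subset_refl] assms(2) by simp
qed

text \<open>Maximality: a larger linear chain \<open>T'\<close> is connected, so it contains the
  square just before or just after the triple, and then the end of the triple next to it is a kink
  of \<open>T'\<close>.\<close>

lemma internal_segment_three:
  assumes i: "i + 4 < length cs"
    and turns: "trn (i + 2) = 1" "trn (i + 3) = 0" "trn (i + 4) = 1"
  shows "internal_segment (set cs) {cs ! (i + 1), cs ! (i + 2), cs ! (i + 3)}"
proof -
  let ?T = "{cs ! (i + 1), cs ! (i + 2), cs ! (i + 3)}"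
  have sub: "?T \<subseteq> set cs" using i by auto
  have "linear_chain ?T"
    using consecutive_cells[of "i + 1"] trn_inner[of "i + 1"] i turns
    by (intro linear_chain_three) (simp_all add: numeral_2_eq_2 numeral_3_eq_3)
  moreover have "T' = ?T" if T': "?T \<subseteq> T'" "T' \<subseteq> set cs" "linear_chain T'" for T'
  proof (rule ccontr)
    assume "T' \<noteq> ?T"
    then obtain y where y: "y \<in> T'" "y \<notin> ?T" using T'(1) by blast
    have "(cs ! (i + 1), y) \<in> {(a, b). a \<in> T' \<and> b \<in> T' \<and> adjacent a b}\<^sup>*"
      using T' y by (auto simp: linear_chain_def polyomino_chain_def polyomino_system_def)
    \<comment> \<open>Invariant along a path in \<open>T'\<close>: it has either stayed in the
      triple or left it across an adjacency.\<close>
    moreover have "z \<in> ?T \<or> (\<exists>a\<in>?T. \<exists>b\<in>T' - ?T. adjacent a b)"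
      if "(cs ! (i + 1), z) \<in> {(a, b). a \<in> T' \<and> b \<in> T' \<and> adjacent a b}\<^sup>*" for z
      using that by (induction rule: rtrancl_induct) blast+
    ultimately obtain a b where ab: "a \<in> ?T" "b \<in> T'" "b \<notin> ?T" "adjacent a b"
      using y by blast
    obtain j where j: "j \<in> {i + 1, i + 2, i + 3}" "a = cs ! j" using ab(1) by auto
    obtain k where k: "k < length cs" "b = cs ! k"
      using ab(2) T'(2) by (metis in_set_conv_nth subsetD)
    have "k \<noteq> i + 1" "k \<noteq> i + 2" "k \<noteq> i + 3" using ab(3) k by auto
    moreover have "j = Suc k \<or> k = Suc j" using ab(4) adj[of j k] i j k by auto
    ultimately consider "k = i" | "k = i + 4" using j(1) by auto
    then show False
    proof cases
      case 1
      then have "kink T' (cs ! (i + 1))"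
        using kink_inner[of i T'] T' ab(2) k i turns by auto
      then show False using T'(1,3) unfolding linear_chain_def by blast
    next
      case 2
      have eq: "i + 2 + 1 = i + 3" "i + 2 + 2 = i + 4" by simp_all
      have "kink T' (cs ! (i + 3))"
        using kink_inner[of "i + 2" T', unfolded eq] T' ab(2) k i turns 2 by auto
      then show False using T'(1,3) unfolding linear_chain_def by blast
    qed
  qed
  ultimately have "segment (set cs) ?T"
    using sub by (auto simp: segment_def)
  moreover have "\<not> terminal (set cs) (cs ! (i + 1))" "\<not> terminal (set cs) (cs ! (i + 2))"
      "\<not> terminal (set cs) (cs ! (i + 3))"
    using not_terminal_inner[of i] not_terminal_inner[of "i + 1"] not_terminal_inner[of "i + 2"] i
    by (simp_all add: numeral_2_eq_2 numeral_3_eq_3)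
  ultimately show ?thesis
    by (auto simp: internal_segment_def external_segment_def)
qed

text \<open>Discharges the last hypothesis of \<open>sum_sides_inner\<close>: a straight square
  between two turns is the middle of an internal segment of length 3.\<close>

lemma Omega_no_U:
  assumes Om: "set cs \<in> Omega n" and i: "i + 2 < length cs"
    and straight: "crn (i + 1) \<inter> crn (i + 3) = {}" and turns: "trn (i + 1) = 1" "trn (i + 3) = 1"
  shows "\<forall>e\<in>sides (cs ! (i + 1)). \<exists>v\<in>e. deg v \<noteq> 3"
proof -
  have "crn i \<inter> crn (i + 2) \<noteq> {}"
    using turns(1) trn_Suc_eq_1[of i] by simp
  moreover have "crn (i + 2) \<inter> crn (i + 4) \<noteq> {}"
  proof -
    have "Suc (i + 2) = i + 3" "i + 2 + 2 = i + 4" by simp_all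
    from trn_Suc_eq_1[of "i + 2", unfolded this] turns(2) show ?thesis by blast
  qed
  ultimately have ne: "crn i \<noteq> {}" "crn (i + 4) \<noteq> {}" by auto
  \<comment> \<open>Turns at squares \<open>i + 1\<close> and \<open>i + 3\<close> need squares
    \<open>i\<close> and \<open>i + 4\<close> to exist, since \<open>crn\<close> is empty out of
    range.\<close>
  have "i \<noteq> 0" using ne(1) by (intro notI) simp
  moreover have "i + 4 \<le> length cs" using ne(2) crn_beyond[of "i + 4"] by linarith
  ultimately obtain j where j: "i = Suc j" "j + 4 < length cs" by (cases i) simp_all
  have eq: "i + 1 = j + 2" "i + 3 = j + 4" using j by simp_all
  have "trn (j + 3) = 0"
  proof -
    have "Suc (j + 2) = j + 3" "j + 2 + 2 = j + 4" by simp_all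
    from trn_Suc[of "j + 2", unfolded this] straight show ?thesis unfolding eq by simp
  qed
  then have "internal_segment (set cs) {cs ! (j + 1), cs ! (j + 2), cs ! (j + 3)}"
    using internal_segment_three[of j] j turns unfolding eq by blast
  moreover have "card {cs ! (j + 1), cs ! (j + 2), cs ! (j + 3)} = 3"
    using j dist by (simp add: nth_eq_iff_index_eq)
  moreover have "sides (cs ! (j + 2)) \<subseteq> edges (cell_graph {cs ! (j + 1), cs ! (j + 2), cs ! (j + 3)})"
    unfolding edges_def cell_graph_def snd_conv by blast
  ultimately have "\<not> (\<exists>e\<in>sides (cs ! (j + 2)). \<forall>v\<in>e. deg v = 3)"
    using Om unfolding Omega_def by blast
  then show ?thesis using j by simp
qed

end

section \<open>Staircases\<close>

lemma turn_offset:
  assumes "adjacent c d" "adjacent d e" "c \<noteq> e" "corners c \<inter> corners e \<noteq> {}"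
  obtains s t :: int where "s \<in> {1, -1}" "t \<in> {1, -1}" "d = c + (s, 0)" "e = d + (0, t)"
  | s t :: int where "s \<in> {1, -1}" "t \<in> {1, -1}" "d = c + (0, t)" "e = d + (s, 0)"
proof -
  obtain x y where d: "d = (x, y)" by force
  have c: "c \<in> {(x - 1, y), (x + 1, y), (x, y - 1), (x, y + 1)}"
    using assms(1) by (cases c) (auto simp: d adjacent_iff)
  have e: "e \<in> {(x - 1, y), (x + 1, y), (x, y - 1), (x, y + 1)}"
    using assms(2) by (cases e) (auto simp: d adjacent_iff)
  have opp: "\<not> (c = (x - 1, y) \<and> e = (x + 1, y))" "\<not> (c = (x + 1, y) \<and> e = (x - 1, y))"
      "\<not> (c = (x, y - 1) \<and> e = (x, y + 1))" "\<not> (c = (x, y + 1) \<and> e = (x, y - 1))"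
    using assms(4) by (auto simp: corners.simps)
  consider s t :: int where "s \<in> {1, -1}" "t \<in> {1, -1}" "c = (x - s, y)" "e = (x, y + t)"
    | s t :: int where "s \<in> {1, -1}" "t \<in> {1, -1}" "c = (x, y - t)" "e = (x + s, y)"
  proof -
    have "(\<exists>s\<in>{1, -1}. c = (x - s, y)) \<and> (\<exists>t\<in>{1, -1}. e = (x, y + t)) \<or>
        (\<exists>t\<in>{1, -1}. c = (x, y - t)) \<and> (\<exists>s\<in>{1, -1}. e = (x + s, y))"
      using c e opp assms(3) by (elim insertE emptyE) simp_all
    then show thesis using that by blast
  qed
  then show thesis
  proof cases
    case 1
    then show thesis by (intro that(1)[of s t]) (simp_all add: d)
  next
    case 2
    then show thesis by (intro that(2)[of s t]) (simp_all add: d)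
  qed
qed

text \<open>Two consecutive turns make horizontal and vertical steps alternate. If the third step
  reversed the first, \<open>c\<^sub>3\<close> would be adjacent to \<open>c\<^sub>0\<close>,
  closing a block of four squares.\<close>

lemma alternating_turns:
  assumes adj: "adjacent c\<^sub>0 c\<^sub>1" "adjacent c\<^sub>1 c\<^sub>2" "adjacent c\<^sub>2 c\<^sub>3" "\<not> adjacent c\<^sub>0 c\<^sub>3"
    and ne: "c\<^sub>0 \<noteq> c\<^sub>2" "c\<^sub>1 \<noteq> c\<^sub>3"
    and turn: "corners c\<^sub>0 \<inter> corners c\<^sub>2 \<noteq> {}" "corners c\<^sub>1 \<inter> corners c\<^sub>3 \<noteq> {}"
  shows "c\<^sub>3 - c\<^sub>2 = c\<^sub>1 - c\<^sub>0"
proof -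
  obtain x y where c0: "c\<^sub>0 = (x, y)" by force
  from adj(1,2) ne(1) turn(1) show ?thesis
  proof (cases rule: turn_offset)
    case (1 s t)
    from adj(2,3) ne(2) turn(2) show ?thesis
    proof (cases rule: turn_offset)
      case (1 s' t')
      then show ?thesis using \<open>c\<^sub>2 = c\<^sub>1 + (0, t)\<close> \<open>t \<in> {1, -1}\<close> by auto
    next
      case (2 s' t')
      then show ?thesis
        using \<open>c\<^sub>2 = c\<^sub>1 + (0, t)\<close> \<open>t \<in> {1, -1}\<close> \<open>s \<in> {1, -1}\<close> \<open>c\<^sub>1 = c\<^sub>0 + (s, 0)\<close> adj(4)
        unfolding c0 by (elim insertE emptyE) (simp_all add: adjacent_iff)
    qed
  next
    case (2 s t)
    from adj(2,3) ne(2) turn(2) show ?thesis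
    proof (cases rule: turn_offset)
      case (1 s' t')
      then show ?thesis
        using \<open>c\<^sub>2 = c\<^sub>1 + (s, 0)\<close> \<open>t \<in> {1, -1}\<close> \<open>s \<in> {1, -1}\<close> \<open>c\<^sub>1 = c\<^sub>0 + (0, t)\<close> adj(4)
        unfolding c0 by (elim insertE emptyE) (simp_all add: adjacent_iff)
    next
      case (2 s' t')
      then show ?thesis using \<open>c\<^sub>2 = c\<^sub>1 + (s, 0)\<close> \<open>s \<in> {1, -1}\<close> by auto
    qed
  qed
qed

section \<open>Graph isomorphisms and invariance of the index\<close>

lemma graph_iso_image:
  assumes inj: "inj \<phi>"
    and corners: "\<And>c. corners (\<psi> c) = \<phi> ` corners c"
    and sides: "\<And>c. sides (\<psi> c) = (`) \<phi> ` sides c"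
  shows "graph_iso (cell_graph S) (cell_graph (\<psi> ` S))"
  unfolding graph_iso_def
proof (intro exI[of _ \<phi>] conjI ballI)
  show "bij_betw \<phi> (verts (cell_graph S)) (verts (cell_graph (\<psi> ` S)))"
    using inj by (auto simp: bij_betw_def verts_def cell_graph_def corners image_UN intro: inj_on_subset)
  fix u v
  have "inj ((`) \<phi>)" using inj by (intro injI) (simp add: inj_image_eq_iff)
  then have "{\<phi> u, \<phi> v} \<in> (`) \<phi> ` sides c \<longleftrightarrow> {u, v} \<in> sides c" for c
    using inj_image_mem_iff[of "(`) \<phi>" "{u, v}" "sides c"] by simp
  then show "{u, v} \<in> edges (cell_graph S) \<longleftrightarrow> {\<phi> u, \<phi> v} \<in> edges (cell_graph (\<psi> ` S))"
    by (simp add: edges_def cell_graph_def sides)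
qed

text \<open>Compares two chains through the common model \<open>G\<close>, which will be the
  staircase.\<close>

lemma graph_iso_cancel:
  assumes "graph_iso G H" "graph_iso G K"
  shows "graph_iso H K"
proof -
  obtain \<phi> where \<phi>: "bij_betw \<phi> (verts G) (verts H)"
    "\<And>u v. u \<in> verts G \<Longrightarrow> v \<in> verts G \<Longrightarrow> {u, v} \<in> edges G \<longleftrightarrow> {\<phi> u, \<phi> v} \<in> edges H"
    using assms(1) unfolding graph_iso_def by blast
  obtain \<psi> where \<psi>: "bij_betw \<psi> (verts G) (verts K)"
    "\<And>u v. u \<in> verts G \<Longrightarrow> v \<in> verts G \<Longrightarrow> {u, v} \<in> edges G \<longleftrightarrow> {\<psi> u, \<psi> v} \<in> edges K"
    using assms(2) unfolding graph_iso_def by blast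
  let ?i = "inv_into (verts G) \<phi>"
  have i: "bij_betw ?i (verts H) (verts G)" using \<phi>(1) by (rule bij_betw_inv_into)
  have "{u, v} \<in> edges H \<longleftrightarrow> {(\<psi> \<circ> ?i) u, (\<psi> \<circ> ?i) v} \<in> edges K"
    if "u \<in> verts H" "v \<in> verts H" for u v
  proof -
    have "?i u \<in> verts G" "?i v \<in> verts G" using i that bij_betwE by blast+
    moreover have "\<phi> (?i u) = u" "\<phi> (?i v) = v"
      using that \<phi>(1) by (simp_all add: bij_betw_inv_into_right)
    ultimately show ?thesis using \<phi>(2)[of "?i u" "?i v"] \<psi>(2)[of "?i u" "?i v"] by simp
  qed
  moreover have "bij_betw (\<psi> \<circ> ?i) (verts H) (verts K)"
    using i \<psi>(1) by (rule bij_betw_trans)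
  ultimately show ?thesis unfolding graph_iso_def by blast
qed

lemma edge_cell_graph:
  assumes "e \<in> edges (cell_graph S)"
  obtains u v where "e = {u, v}" "u \<in> verts (cell_graph S)" "v \<in> verts (cell_graph S)"
proof -
  obtain x y where "(x, y) \<in> S" "e \<in> sides (x, y)"
    using assms by (auto simp: edges_def cell_graph_def)
  moreover have "corners (x, y) \<subseteq> verts (cell_graph S)"
    using \<open>(x, y) \<in> S\<close> by (auto simp: verts_def cell_graph_def)
  ultimately show thesis
    unfolding sides.simps corners.simps by (elim insertE emptyE) (auto intro: that)
qed

text \<open>The easy direction of the equality clause. \<open>graph_iso\<close> speaks of pairs of
  vertices, so \<open>edge_cell_graph\<close> is used to see every edge as such a pair.\<close>

lemma sum_connectivity_iso:
  assumes iso: "graph_iso (cell_graph S) (cell_graph T)"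
  shows "sum_connectivity \<alpha> (cell_graph S) = sum_connectivity \<alpha> (cell_graph T)"
proof -
  let ?G = "cell_graph S" and ?H = "cell_graph T"
  obtain \<phi> where bij: "bij_betw \<phi> (verts ?G) (verts ?H)"
    and edge: "\<And>u v. u \<in> verts ?G \<Longrightarrow> v \<in> verts ?G \<Longrightarrow> {u, v} \<in> edges ?G \<longleftrightarrow> {\<phi> u, \<phi> v} \<in> edges ?H"
    using iso unfolding graph_iso_def by blast
  have inj: "inj_on \<phi> (verts ?G)" using bij by (rule bij_betw_imp_inj_on)
  have sub: "e \<subseteq> verts ?G" if "e \<in> edges ?G" for e
    using edge_cell_graph[OF that] by (metis insert_subset empty_subsetI)
  have inj_edges: "inj_on ((`) \<phi>) (edges ?G)"
  proof (rule inj_onI)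
    fix e e' assume "e \<in> edges ?G" "e' \<in> edges ?G" "\<phi> ` e = \<phi> ` e'"
    then show "e = e'" using inj_on_image_eq_iff[OF inj] sub by blast
  qed
  have img: "(`) \<phi> ` edges ?G = edges ?H"
  proof (intro equalityI subsetI)
    fix e' assume "e' \<in> (`) \<phi> ` edges ?G"
    then obtain e where e: "e \<in> edges ?G" "e' = \<phi> ` e" by blast
    from e(1) obtain u v where "e = {u, v}" "u \<in> verts ?G" "v \<in> verts ?G"
      by (rule edge_cell_graph)
    then show "e' \<in> edges ?H" using edge e by simp
  next
    fix e' assume e': "e' \<in> edges ?H"
    then obtain u' v' where uv': "e' = {u', v'}" "u' \<in> verts ?H" "v' \<in> verts ?H"
      by (rule edge_cell_graph)
    then obtain u v where uv: "u \<in> verts ?G" "v \<in> verts ?G" "u' = \<phi> u" "v' = \<phi> v"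
      using bij unfolding bij_betw_def by blast
    then have "{u, v} \<in> edges ?G" using edge e' uv' by blast
    moreover have "e' = \<phi> ` {u, v}" using uv uv' by simp
    ultimately show "e' \<in> (`) \<phi> ` edges ?G" by blast
  qed
  have deg: "degree ?H (\<phi> v) = degree ?G v" if v: "v \<in> verts ?G" for v
  proof -
    have "{e' \<in> edges ?H. \<phi> v \<in> e'} = (`) \<phi> ` {e \<in> edges ?G. v \<in> e}"
      unfolding img[symmetric] using inj_on_image_mem_iff[OF inj v] sub by blast
    moreover have "inj_on ((`) \<phi>) {e \<in> edges ?G. v \<in> e}"
      using inj_edges by (rule inj_on_subset) blast
    ultimately show ?thesis
      by (simp add: degree_def card_image)
  qed
  have "(\<Sum>e\<in>edges ?H. real (\<Sum>u\<in>e. degree ?H u) powr \<alpha>) =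
      (\<Sum>e\<in>edges ?G. real (\<Sum>u\<in>\<phi> ` e. degree ?H u) powr \<alpha>)"
    unfolding img[symmetric] using inj_edges by (simp add: sum.reindex)
  also have "\<dots> = (\<Sum>e\<in>edges ?G. real (\<Sum>u\<in>e. degree ?G u) powr \<alpha>)"
  proof (rule sum.cong[OF refl])
    fix e assume e: "e \<in> edges ?G"
    have "(\<Sum>u\<in>\<phi> ` e. degree ?H u) = (\<Sum>u\<in>e. degree ?H (\<phi> u))"
      using inj_on_subset[OF inj sub[OF e]] by (simp add: sum.reindex)
    also have "\<dots> = (\<Sum>u\<in>e. degree ?G u)"
      using sub[OF e] deg by (intro sum.cong) auto
    finally show "real (\<Sum>u\<in>\<phi> ` e. degree ?H u) powr \<alpha> = real (\<Sum>u\<in>e. degree ?G u) powr \<alpha>"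
      by simp
  qed
  finally show ?thesis by (simp add: sum_connectivity_def)
qed

text \<open>The model zigzag chain: from the origin it steps right and up in turn.\<close>

definition staircase :: "nat \<Rightarrow> cell set" where
  "staircase n = (\<lambda>i. (int ((i + 1) div 2), int (i div 2))) ` {..<n}"

text \<open>The affine map that sends the origin to \<open>p\<close> and the two unit steps to
  \<open>u\<close> and \<open>v\<close>.\<close>

definition place :: "cell \<Rightarrow> cell \<Rightarrow> cell \<Rightarrow> cell \<Rightarrow> cell" where
  "place p u v c = p + (fst c * fst u + snd c * fst v, fst c * snd u + snd c * snd v)"

text \<open>Cells are named by their lower left corner, which a rotation or reflection need not
  preserve; \<open>o\<^sub>1\<close> and \<open>o\<^sub>2\<close> shift the map of cells to a map of vertices.\<close>

lemma graph_iso_place: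
  assumes uv: "(\<exists>s\<in>{1, -1}. \<exists>t\<in>{1, -1}. u = (s, 0) \<and> v = (0, t)) \<or>
    (\<exists>s\<in>{1, -1}. \<exists>t\<in>{1, -1}. u = (0, t) \<and> v = (s, 0))"
  shows "graph_iso (cell_graph S) (cell_graph (place p u v ` S))"
proof -
  define o\<^sub>1 o\<^sub>2 :: int where "o\<^sub>1 = of_bool (fst u = -1 \<or> fst v = -1)"
    and "o\<^sub>2 = of_bool (snd u = -1 \<or> snd v = -1)"
  let ?\<phi> = "\<lambda>c. place p u v c + (o\<^sub>1, o\<^sub>2)"
  obtain p\<^sub>1 p\<^sub>2 where p: "p = (p\<^sub>1, p\<^sub>2)" by force
  have cells: "corners (place p u v c) = ?\<phi> ` corners c \<and> sides (place p u v c) = (`) ?\<phi> ` sides c"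
    for c
  proof -
    obtain x y where c: "c = (x, y)" by force
    consider "u = (1, 0)" "v = (0, 1)" | "u = (1, 0)" "v = (0, -1)"
      | "u = (-1, 0)" "v = (0, 1)" | "u = (-1, 0)" "v = (0, -1)"
      | "u = (0, 1)" "v = (1, 0)" | "u = (0, -1)" "v = (1, 0)"
      | "u = (0, 1)" "v = (-1, 0)" | "u = (0, -1)" "v = (-1, 0)"
      using uv by auto
    then show ?thesis
      by cases (simp_all add: c place_def o\<^sub>1_def o\<^sub>2_def p corners.simps sides.simps
        insert_commute algebra_simps)
  qed
  have "inj ?\<phi>"
    using uv by (intro injI) (auto simp: place_def prod_eq_iff)
  then show ?thesis
    using cells by (intro graph_iso_image) auto
qed

context cell_path
begin

text \<open>By \<open>alternating_turns\<close> the steps between consecutive squares have period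
  two, so the first three squares determine the chain, and \<open>place\<close> carries the
  staircase onto it.\<close>

lemma graph_iso_staircase:
  assumes n: "3 \<le> length cs" and turns: "\<And>i. i + 2 < length cs \<Longrightarrow> trn (i + 2) = 1"
  shows "graph_iso (cell_graph (staircase (length cs))) (cell_graph (set cs))"
proof -
  have meet: "corners (cs ! i) \<inter> corners (cs ! (i + 2)) \<noteq> {}" if "i + 2 < length cs" for i
    using turns[OF that] trn_inner[OF that] by (auto split: if_splits)
  define u v where "u = cs ! 1 - cs ! 0" and "v = cs ! 2 - cs ! 1"
  have 0: "0 + 2 < length cs" using n by simp
  have uv: "(\<exists>s\<in>{1, -1}. \<exists>t\<in>{1, -1}. u = (s, 0) \<and> v = (0, t)) \<or>
      (\<exists>s\<in>{1, -1}. \<exists>t\<in>{1, -1}. u = (0, t) \<and> v = (s, 0))"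
    using consecutive_cells[OF 0] meet[OF 0]
  proof (cases rule: turn_offset)
    case (1 s t)
    then show ?thesis by (intro disjI1 bexI[of _ s] bexI[of _ t]) (simp_all add: u_def v_def numeral_2_eq_2)
  next
    case (2 s t)
    then show ?thesis by (intro disjI2 bexI[of _ s] bexI[of _ t]) (simp_all add: u_def v_def numeral_2_eq_2)
  qed
  have step: "cs ! (i + 1) - cs ! i = (if even i then u else v)" if "i + 1 < length cs" for i
    using that
  proof (induction i rule: less_induct)
    case (less i)
    consider "i = 0" | "i = 1" | j where "i = j + 2"
      by (metis One_nat_def Suc_1 add.commute add_2_eq_Suc' old.nat.exhaust)
    then show ?case
    proof cases
      case 1
      then show ?thesis by (simp add: u_def)
    next
      case 2
      then show ?thesis by (simp add: v_def numeral_2_eq_2)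
    next
      case 3
      then have j: "j + 2 < length cs" "j + 1 + 2 < length cs" "j + 3 < length cs"
        using less.prems by simp_all
      have eq: "j + 1 + 1 = j + 2" "j + 1 + 2 = j + 3" by simp_all
      have "cs ! (j + 3) - cs ! (j + 2) = cs ! (j + 1) - cs ! j"
        using consecutive_cells[OF j(1)] consecutive_cells[OF j(2), unfolded eq] meet[OF j(1)]
          meet[OF j(2), unfolded eq] adj[of j "j + 3"] j(3)
        by (intro alternating_turns) simp_all
      then show ?thesis using less.IH[of j] less.prems 3 by (simp add: numeral_3_eq_3)
    qed
  qed
  have "cs ! i = place (cs ! 0) u v (int ((i + 1) div 2), int (i div 2))" if "i < length cs" for i
    using that
  proof (induction i)
    case 0
    then show ?case by (simp add: place_def prod_eq_iff)
  next
    case (Suc i)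
    then have "cs ! Suc i = cs ! i + (if even i then u else v)"
      using step[of i] by (simp add: algebra_simps)
    also have "cs ! i = place (cs ! 0) u v (int ((i + 1) div 2), int (i div 2))"
      using Suc by simp
    finally show ?case
      by (cases "even i") (auto simp: place_def prod_eq_iff algebra_simps elim!: evenE oddE)
  qed
  then have "place (cs ! 0) u v ` staircase (length cs) = (!) cs ` {..<length cs}"
    unfolding staircase_def image_image by (intro image_cong) auto
  also have "\<dots> = set cs" by (auto simp: set_conv_nth)
  finally show ?thesis
    using graph_iso_place[OF uv, of "staircase (length cs)" "cs ! 0"] by simp
qed

end

section \<open>Minimality of the zigzag chain\<close>

text \<open>AM-GM and \<open>5 * 7 < 6\<^sup>2\<close>.\<close>

lemma powr_5_7:
  fixes \<alpha> :: real
  assumes "\<alpha> < 0"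
  shows "2 * 6 powr \<alpha> < 5 powr \<alpha> + 7 powr \<alpha>"
proof (rule power2_less_imp_less)
  have "(2 * 6 powr \<alpha>)\<^sup>2 = 4 * 36 powr \<alpha>"
    by (simp add: power2_eq_square flip: powr_mult)
  also have "\<dots> < 4 * 35 powr \<alpha>"
    using powr_less_mono2_neg[OF assms, of 35 36] by simp
  also have "\<dots> = 4 * (5 powr \<alpha> * 7 powr \<alpha>)"
    by (simp flip: powr_mult)
  also have "\<dots> \<le> (5 powr \<alpha> + 7 powr \<alpha>)\<^sup>2"
    using zero_le_power2[of "5 powr \<alpha> - 7 powr \<alpha>"] by (simp add: power2_eq_square algebra_simps)
  finally show "(2 * 6 powr \<alpha>)\<^sup>2 < (5 powr \<alpha> + 7 powr \<alpha>)\<^sup>2" .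
qed simp

text \<open>The left side is \<open>2 * 6 powr \<alpha> + 8 powr \<alpha>\<close>. Against two
  zeros, 6 is compared with 8; against a mixed pair, \<open>powr_5_7\<close> handles one 7 and the
  other is compared with 8.\<close>

lemma pair_weight_less:
  assumes "\<alpha> < 0" "s \<le> 1" "t \<le> 1" "\<not> (s = 1 \<and> t = 1)"
  shows "pair_weight \<alpha> 1 1 < pair_weight \<alpha> s t"
proof -
  have "s = 0 \<and> t = 0 \<or> s = 0 \<and> t = 1 \<or> s = 1 \<and> t = 0" using assms(2-4) by linarith
  then show ?thesis
    using powr_less_mono2_neg[OF assms(1), of 6 8] powr_less_mono2_neg[OF assms(1), of 7 8]
      powr_5_7[OF assms(1)] by (auto simp: pair_weight_def)
qed

lemma end_weight_less:
  assumes "\<alpha> < 0" "t \<le> 1" "t \<noteq> 1"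
  shows "end_weight \<alpha> 1 < end_weight \<alpha> t"
proof -
  have "t = 0" using assms(2,3) by linarith
  then show ?thesis
    using powr_less_mono2_neg[OF assms(1), of 6 7] by (simp add: end_weight_def)
qed

theorem proposition2p5:
  fixes f :: "real \<Rightarrow> real" and x0 \<alpha> :: real and n :: nat and B Z :: "cell set"
  assumes "\<And>t. f t = 2 * 5 powr t - 6 powr (t + 1) + 4 * 7 powr t"
    and "f x0 = 0" and "\<bar>x0 - (- 3.09997)\<bar> < 0.00001"
    and "n \<ge> 3"
    and "B \<in> Omega n"
    and "zigzag_chain n Z"
    and "\<alpha> \<le> x0"
  shows "sum_connectivity \<alpha> (cell_graph B) \<ge> sum_connectivity \<alpha> (cell_graph Z) \<and>
    (sum_connectivity \<alpha> (cell_graph B) = sum_connectivity \<alpha> (cell_graph Z) \<longleftrightarrow>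
       graph_iso (cell_graph B) (cell_graph Z))"
proof -
  have \<alpha>: "\<alpha> < 0" using assms(3,7) by linarith
  have B: "polyomino_chain B" "card B = n" and Z: "polyomino_chain Z" "card Z = n"
    using assms(5,6) by (simp_all add: Omega_def zigzag_chain_def)
  obtain bs where bs: "cell_path bs" "set bs = B" using B(1) by (rule cell_path_of_chain)
  obtain zs where zs: "cell_path zs" "set zs = Z" using Z(1) by (rule cell_path_of_chain)
  interpret b: cell_path bs by (rule bs(1))
  interpret z: cell_path zs by (rule zs(1))
  obtain m where m: "n = m + 3" using assms(4) by (metis add.commute le_Suc_ex)
  have len: "length bs = m + 3" "length zs = m + 3"
    using B Z bs zs m b.dist z.dist by (metis distinct_card)+
  have turns: "z.trn (i + 2) = 1" if "i + 2 < length zs" for i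
    using z.zigzag_turns assms(6) that zs(2) by blast
  define c where "c = 2 * 4 powr \<alpha> + 2 * 5 powr \<alpha>"
  have \<chi>B: "sum_connectivity \<alpha> (cell_graph B) = c + end_weight \<alpha> (b.trn 2) +
      end_weight \<alpha> (b.trn (m + 2)) + (\<Sum>j<m. pair_weight \<alpha> (b.trn (j + 2)) (b.trn (j + 3)))"
    using b.sum_connectivity_cell_path[OF len(1)] b.Omega_no_U[of n] assms(5) bs(2) by (simp add: c_def)
  have \<chi>Z: "sum_connectivity \<alpha> (cell_graph Z) = c + end_weight \<alpha> 1 + end_weight \<alpha> 1 +
      (\<Sum>j<m. pair_weight \<alpha> 1 1)"
  proof -
    have "z.trn 2 = 1" "z.trn (m + 2) = 1"
      using turns[of 0] turns[of m] len by (simp_all add: numeral_2_eq_2)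
    moreover have "z.trn (j + 2) = 1" "z.trn (j + 3) = 1" if "j < m" for j
      using turns[of j] turns[of "j + 1"] len that by (simp_all add: numeral_3_eq_3)
    \<comment> \<open>The zigzag chain has no straight inner square, so the hypothesis
      \<open>no_U\<close> of the index formula holds vacuously.\<close>
    moreover have "\<not> (z.crn (i + 1) \<inter> z.crn (i + 3) = {})" if "i + 2 < length zs" for i
      using turns[OF that] z.trn_Suc_eq_1[of "i + 1"] by (simp add: numeral_3_eq_3)
    ultimately show ?thesis
      using z.sum_connectivity_cell_path[OF len(2)] zs(2) by (simp add: c_def)
  qed
  \<comment> \<open>The excess of \<open>B\<close> over \<open>Z\<close>, split by ends and pairs.
    Each part is nonnegative and vanishes only at turns, so equality of the indices makes every part
    vanish.\<close>
  define e where "e t = end_weight \<alpha> t - end_weight \<alpha> 1" for t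
  define d where "d j = pair_weight \<alpha> (b.trn (j + 2)) (b.trn (j + 3)) - pair_weight \<alpha> 1 1" for j
  have diff: "sum_connectivity \<alpha> (cell_graph B) - sum_connectivity \<alpha> (cell_graph Z) =
      e (b.trn 2) + e (b.trn (m + 2)) + (\<Sum>j<m. d j)"
    unfolding \<chi>B \<chi>Z e_def d_def sum_subtractf by simp
  have e: "0 \<le> e (b.trn i)" "e (b.trn i) = 0 \<longleftrightarrow> b.trn i = 1" for i
    using end_weight_less[OF \<alpha> b.trn_le_1, of i] by (cases "b.trn i = 1"; simp add: e_def)+
  have d: "0 \<le> d j" "d j = 0 \<longleftrightarrow> b.trn (j + 2) = 1 \<and> b.trn (j + 3) = 1" for j
    using pair_weight_less[OF \<alpha> b.trn_le_1 b.trn_le_1, of "j + 2" "j + 3"]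
    by (cases "b.trn (j + 2) = 1 \<and> b.trn (j + 3) = 1"; simp add: d_def)+
  have ge: "0 \<le> e (b.trn 2)" "0 \<le> e (b.trn (m + 2))" "0 \<le> (\<Sum>j<m. d j)"
    using e(1) d(1) by (auto intro: sum_nonneg)
  have "graph_iso (cell_graph B) (cell_graph Z)"
    if eq: "sum_connectivity \<alpha> (cell_graph B) = sum_connectivity \<alpha> (cell_graph Z)"
  proof -
    have "e (b.trn 2) = 0" "e (b.trn (m + 2)) = 0" and sum: "(\<Sum>j<m. d j) = 0"
      using diff ge eq by linarith+
    moreover have "d j = 0" if "j < m" for j
      using sum d(1) that by (simp add: sum_nonneg_eq_0_iff)
    \<comment> \<open>The last inner square, number \<open>m + 2\<close>, is settled by its end
      term, every other inner square by the pair it begins.\<close>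
    ultimately have "b.trn (i + 2) = 1" if "i + 2 < length bs" for i
      using that len(1) e(2) d(2) by (cases "i = m") auto
    then have "graph_iso (cell_graph (staircase (m + 3))) (cell_graph B)"
      using b.graph_iso_staircase len(1) bs(2) by simp
    moreover have "graph_iso (cell_graph (staircase (m + 3))) (cell_graph Z)"
      using z.graph_iso_staircase turns len(2) zs(2) by simp
    ultimately show ?thesis by (rule graph_iso_cancel)
  qed
  then show ?thesis
    using diff ge sum_connectivity_iso[of B Z \<alpha>] by auto
qed

end
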